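(* Let $k \ge 2$ and let $\Omega \subset \{1,\dots,k\}^{\mathbb{Z}}$ be a minimal aperiodic subshift in which every letter of $\{1,\dots,k\}$ occurs. Then for any $0<\gamma<\frac14$ the following is true. For any non-constant function $v:\{1,\dots,k\}\to\mathbb{R}$ there exists $C>0$ such that for any $\lambda>0$, the Lebesgue measure of the spectrum of the Schr\"odinger operator over $\Omega$ with potential $\lambda v$ is smaller than $C\lambda^{-\gamma}$.
   Context: A subshift $\Omega\subset\{1,\dots,k\}^{\mathbb{Z}}$ is a nonempty compact (product topology of discrete spaces) set invariant under the shift $T$, $(T\omega)_n=\omega_{n+1}$. It is minimal if every $T$-orbit $\{T^n\omega\}_{n\in\mathbb{Z}}$, $\omega \in \Omega$, is dense in $\Omega$, and aperiodic if it contains no $T$-periodic point (for a minimal subshift: if it is not a single periodic orbit). A letter $a$ occurs in $\Omega$ if $\omega_0=a$ for some $\omega\in\Omega$. For a function $w:\{1,\dots,k\}\to\mathbb{R}$ and $\omega\in\Omega$, the Schr\"odinger operator with potential $w$ is the bounded self-adjoint operator on $\ell^2(\mathbb{Z})$ given by $(H_\omega u)_n=u_{n+1}+u_{n-1}+w(\omega_n)u_n$. When $\Omega$ is minimal the spectrum of $H_\omega$ is the same for all $\omega\in\Omega$; this common set is called the spectrum of the Schr\"odinger operator over $\Omega$ with potential $w$. *)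

theory Defs
  imports "HOL-Analysis.Analysis"
begin

section \<open>Subshifts\<close>

definition full_shift :: "nat \<Rightarrow> (int \<Rightarrow> nat) topology" where
  "full_shift k = product_topology (\<lambda>_. discrete_topology {1..k}) UNIV"

definition shift :: "(int \<Rightarrow> nat) \<Rightarrow> (int \<Rightarrow> nat)" where
  "shift \<omega> = (\<lambda>n. \<omega> (n + 1))"

text \<open>The two-sided orbit: \<open>shift\<close> is invertible on two-sided sequences, and its
  \<open>j\<close>-th power, for an arbitrary integer \<open>j\<close>, is \<open>\<omega> \<mapsto> (\<lambda>n. \<omega> (n + j))\<close>.\<close>

definition orbit :: "(int \<Rightarrow> nat) \<Rightarrow> (int \<Rightarrow> nat) set" where
  "orbit \<omega> = range (\<lambda>j::int. \<lambda>n. \<omega> (n + j))"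

text \<open>\<open>compactin\<close> includes that \<open>\<Omega>\<close> consists of sequences with values in \<open>{1..k}\<close>.\<close>

definition subshift :: "nat \<Rightarrow> (int \<Rightarrow> nat) set \<Rightarrow> bool" where
  "subshift k \<Omega> \<longleftrightarrow> \<Omega> \<noteq> {} \<and> compactin (full_shift k) \<Omega> \<and> shift ` \<Omega> = \<Omega>"

definition minimal_subshift :: "nat \<Rightarrow> (int \<Rightarrow> nat) set \<Rightarrow> bool" where
  "minimal_subshift k \<Omega> \<longleftrightarrow>
     subshift k \<Omega> \<and> (\<forall>\<omega>\<in>\<Omega>. \<Omega> \<subseteq> full_shift k closure_of orbit \<omega>)"

definition aperiodic :: "(int \<Rightarrow> nat) set \<Rightarrow> bool" where
  "aperiodic \<Omega> \<longleftrightarrow> \<not> (\<exists>\<omega>\<in>\<Omega>. \<exists>p\<ge>1. (shift ^^ p) \<omega> = \<omega>)"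

definition occurs :: "nat \<Rightarrow> (int \<Rightarrow> nat) set \<Rightarrow> bool" where
  "occurs a \<Omega> \<longleftrightarrow> (\<exists>\<omega>\<in>\<Omega>. \<omega> 0 = a)"


section \<open>Bounded operators on \<open>\<ell>\<^sup>2(\<int>)\<close> and their spectrum\<close>

definition ell2 :: "(int \<Rightarrow> complex) set" where
  "ell2 = {u. (\<lambda>n. (cmod (u n))\<^sup>2) summable_on UNIV}"

definition ell2_norm :: "(int \<Rightarrow> complex) \<Rightarrow> real" where
  "ell2_norm u = sqrt (\<Sum>\<^sub>\<infinity>n. (cmod (u n))\<^sup>2)"

text \<open>Operators are functions on all sequences, of which only the restriction to
  \<open>ell2\<close> matters.\<close>

definition bounded_operator :: "((int \<Rightarrow> complex) \<Rightarrow> (int \<Rightarrow> complex)) \<Rightarrow> bool" where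
  "bounded_operator A \<longleftrightarrow>
     A ` ell2 \<subseteq> ell2 \<and>
     (\<forall>u\<in>ell2. \<forall>v\<in>ell2. A (\<lambda>n. u n + v n) = (\<lambda>n. A u n + A v n)) \<and>
     (\<forall>c. \<forall>u\<in>ell2. A (\<lambda>n. c * u n) = (\<lambda>n. c * A u n)) \<and>
     (\<exists>K. \<forall>u\<in>ell2. ell2_norm (A u) \<le> K * ell2_norm u)"

text \<open>The spectrum of a bounded operator \<open>A\<close>: the complex numbers \<open>z\<close> for which \<open>A - z\<close> has
  no bounded two-sided inverse.\<close>

definition spectrum :: "((int \<Rightarrow> complex) \<Rightarrow> (int \<Rightarrow> complex)) \<Rightarrow> complex set" where
  "spectrum A = {z. \<not> (\<exists>R. bounded_operator R \<and>
     (\<forall>u\<in>ell2. R (\<lambda>n. A u n - z * u n) = u) \<and>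
     (\<forall>u\<in>ell2. (\<lambda>n. A (R u) n - z * R u n) = u))}"


section \<open>Schroedinger operators over a subshift\<close>

definition schroedinger ::
  "(nat \<Rightarrow> real) \<Rightarrow> (int \<Rightarrow> nat) \<Rightarrow> (int \<Rightarrow> complex) \<Rightarrow> (int \<Rightarrow> complex)" where
  "schroedinger w \<omega> u = (\<lambda>n. u (n + 1) + u (n - 1) + complex_of_real (w (\<omega> n)) * u n)"

text \<open>The common spectrum of all operators \<open>schroedinger w \<omega>\<close>, \<open>\<omega> \<in> \<Omega>\<close>. For minimal \<open>\<Omega>\<close>
  the spectrum does not depend on \<open>\<omega>\<close>. It is contained in the real axis, the
  operators being self-adjoint, and is taken here as a set of reals.\<close>

definition subshift_spectrum :: "(int \<Rightarrow> nat) set \<Rightarrow> (nat \<Rightarrow> real) \<Rightarrow> real set" where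
  "subshift_spectrum \<Omega> w =
     (THE S. \<forall>\<omega>\<in>\<Omega>. complex_of_real -` spectrum (schroedinger w \<omega>) = S)"

end

theory Submission
  imports Defs
begin

text \<open>
  For large coupling the spectrum is in fact contained in finitely many intervals of length
  \<open>O(1 / lam)\<close>, with centres at \<open>lam * x + 2 cos (m \<pi> / N)\<close>, where \<open>x\<close> runs through the
  values of \<open>v\<close> and \<open>N\<close> is bounded. The reason is that, at an energy \<open>E\<close> whose closest
  value of the potential is \<open>lam * x\<close>, all sites with another value are separated from \<open>E\<close>
  by a multiple of \<open>lam\<close> and act as walls. By minimality every letter recurs with bounded
  gaps (\<open>minimal_letter_syndetic\<close>), and \<open>v\<close> takes two values, so the runs between the walls
  have bounded length. Between the walls the operator is, up to a coupling of order
  \<open>1 / lam\<close>, a direct sum of copies of finitely many Dirichlet Laplacians shifted by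
  \<open>lam * x\<close>, and these have the eigenvalues above.

  To make this quantitative, the equation \<open>(H - E) u = f\<close> is solved on a run by the discrete
  sine transform, which bounds \<open>u\<close> on the run by \<open>f\<close> and the two boundary values, divided by
  the distance of \<open>E\<close> from the eigenvalues (\<open>dirichlet_run_bound\<close>); on a wall, \<open>u\<close> is
  bounded by \<open>f\<close> and its neighbours, divided by a multiple of \<open>lam\<close>. If \<open>E\<close> has distance
  \<open>K / lam\<close> from the eigenvalues, with \<open>K\<close> large, the terms with \<open>u\<close> can be absorbed and
  \<open>H - E\<close> is bounded below (\<open>notin_spectrum_if_bounded_runs\<close>).

  That a lower bound excludes \<open>E\<close> from the spectrum is a property of self-adjoint operators
  (\<open>notin_spectrum_iff_bounded_below\<close>). It is proved for Jacobi operators by the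
  iteration \<open>u \<mapsto> u - t J (J u - f)\<close>, a contraction whose fixed point solves \<open>J u = f\<close>. The
  same criterion, which tests finitely supported sequences only, shows that the spectrum does
  not depend on the point of a minimal subshift (\<open>subshift_spectrum_eq\<close>).
\<close>

section \<open>Square-summable sequences\<close>

definition sqnorm :: "(int \<Rightarrow> complex) \<Rightarrow> real" where
  "sqnorm u = (\<Sum>\<^sub>\<infinity>n. (cmod (u n))\<^sup>2)"

lemma sqnorm_nonneg [simp]: "0 \<le> sqnorm u"
  unfolding sqnorm_def by (rule infsum_nonneg) simp

lemma ell2_norm_eq_sqrt_sqnorm: "ell2_norm u = sqrt (sqnorm u)"
  by (simp add: ell2_norm_def sqnorm_def)

lemma finite_sum_le_sqnorm:
  assumes "u \<in> ell2" "finite F"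
  shows "(\<Sum>n\<in>F. (cmod (u n))\<^sup>2) \<le> sqnorm u"
  unfolding sqnorm_def using assms by (intro finite_sum_le_infsum) (auto simp: ell2_def)

lemma cmod_le_sqrt_sqnorm:
  assumes "u \<in> ell2"
  shows "cmod (u n) \<le> sqrt (sqnorm u)"
  using finite_sum_le_sqnorm[OF assms, of "{n}"] by (simp add: real_le_rsqrt)

lemma ell2_finite_sums_bound:
  assumes "\<And>F. finite F \<Longrightarrow> (\<Sum>n\<in>F. (cmod (u n))\<^sup>2) \<le> b"
  shows "u \<in> ell2" "sqnorm u \<le> b"
proof -
  show u: "u \<in> ell2"
    unfolding ell2_def mem_Collect_eq
    by (rule nonneg_bdd_above_summable_on) (auto intro!: bdd_aboveI[of _ b] assms)
  show "sqnorm u \<le> b"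
    unfolding sqnorm_def using u assms by (intro infsum_le_finite_sums) (auto simp: ell2_def)
qed

lemma ell2_finite_support:
  assumes "finite {n. u n \<noteq> 0}"
  shows "u \<in> ell2"
proof -
  have "(\<lambda>n. (cmod (u n))\<^sup>2) summable_on {n. u n \<noteq> 0}"
    using assms by simp
  then have "(\<lambda>n. (cmod (u n))\<^sup>2) summable_on UNIV"
    by (rule summable_on_cong_neutral[THEN iffD1, rotated -1]) auto
  then show ?thesis by (simp add: ell2_def)
qed

text \<open>
  The equation gives pointwise bounds: the modulus at a site is bounded by the moduli at the
  sites within a fixed distance. Squaring and summing such a bound yields an \<open>\<ell>\<^sup>2\<close>
  estimate directly, without decomposing the lattice into blocks.
\<close>

definition window_sum :: "nat \<Rightarrow> (int \<Rightarrow> complex) \<Rightarrow> int \<Rightarrow> real" where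
  "window_sum M u n = (\<Sum>m\<in>{- int M..int M}. cmod (u (n + m)))"

lemma window_sum_nonneg: "0 \<le> window_sum M u n"
  unfolding window_sum_def by (rule sum_nonneg) simp

text \<open>
  Cauchy--Schwarz produces one factor \<open>2 M + 1\<close>; the other one counts the translates of
  \<open>u\<close> that occur in the window.
\<close>

lemma sum_window_sum_le:
  assumes "u \<in> ell2" "finite F"
  shows "(\<Sum>n\<in>F. (window_sum M u n)\<^sup>2) \<le> (2 * real M + 1)\<^sup>2 * sqnorm u"
proof -
  let ?I = "{- int M..int M}"
  have card: "real (card ?I) = 2 * real M + 1" by simp
  have "(\<Sum>n\<in>F. (window_sum M u n)\<^sup>2)
      \<le> (\<Sum>n\<in>F. (\<Sum>m\<in>?I. (cmod (u (n + m)))\<^sup>2) * card ?I)"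
    unfolding window_sum_def by (intro sum_mono sum_squared_le_sum_of_squares)
  also have "\<dots> = (\<Sum>m\<in>?I. \<Sum>n\<in>F. (cmod (u (n + m)))\<^sup>2) * (2 * real M + 1)"
    unfolding card sum_distrib_right[symmetric] by (subst sum.swap) (rule refl)
  also have "\<dots> \<le> (\<Sum>m\<in>?I. sqnorm u) * (2 * real M + 1)"
  proof (intro mult_right_mono sum_mono)
    fix m
    have "(\<Sum>n\<in>F. (cmod (u (n + m)))\<^sup>2) = (\<Sum>n\<in>(\<lambda>n. n + m) ` F. (cmod (u n))\<^sup>2)"
      by (subst sum.reindex) (auto simp: inj_on_def)
    also have "\<dots> \<le> sqnorm u"
      using assms by (intro finite_sum_le_sqnorm) auto
    finally show "(\<Sum>n\<in>F. (cmod (u (n + m)))\<^sup>2) \<le> sqnorm u" .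
  qed simp
  also have "\<dots> = (2 * real M + 1)\<^sup>2 * sqnorm u"
    by (simp add: power2_eq_square)
  finally show ?thesis .
qed

text \<open>
  With \<open>M = 0\<close> this gives the closure of \<open>\<ell>\<^sup>2\<close> under linear combinations, and with larger
  windows its invariance under translations and under Jacobi operators.
\<close>

lemma ell2_window_bound:
  assumes f: "f \<in> ell2" and g: "g \<in> ell2"
    and le: "\<And>n. cmod (u n) \<le> \<alpha> * window_sum M f n + \<beta> * window_sum M g n"
  shows "u \<in> ell2" "sqnorm u \<le> 2 * (2 * real M + 1)\<^sup>2 * (\<alpha>\<^sup>2 * sqnorm f + \<beta>\<^sup>2 * sqnorm g)"
proof -
  have "(\<Sum>n\<in>F. (cmod (u n))\<^sup>2) \<le> 2 * (2 * real M + 1)\<^sup>2 * (\<alpha>\<^sup>2 * sqnorm f + \<beta>\<^sup>2 * sqnorm g)"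
    if F: "finite F" for F
  proof -
    have sq: "(x + y)\<^sup>2 \<le> 2 * x\<^sup>2 + 2 * y\<^sup>2" for x y :: real
      using zero_le_power2[of "x - y"] by (simp add: power2_sum power2_diff)
    have "(\<Sum>n\<in>F. (cmod (u n))\<^sup>2)
        \<le> (\<Sum>n\<in>F. 2 * (\<alpha> * window_sum M f n)\<^sup>2 + 2 * (\<beta> * window_sum M g n)\<^sup>2)"
      by (intro sum_mono order_trans[OF power_mono[OF le] sq]) simp
    also have "\<dots> = 2 * \<alpha>\<^sup>2 * (\<Sum>n\<in>F. (window_sum M f n)\<^sup>2) + 2 * \<beta>\<^sup>2 * (\<Sum>n\<in>F. (window_sum M g n)\<^sup>2)"
      by (simp add: sum.distrib sum_distrib_left power_mult_distrib mult.assoc)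
    also have "\<dots> \<le> 2 * \<alpha>\<^sup>2 * ((2 * real M + 1)\<^sup>2 * sqnorm f) + 2 * \<beta>\<^sup>2 * ((2 * real M + 1)\<^sup>2 * sqnorm g)"
      by (intro add_mono mult_left_mono sum_window_sum_le f g F) auto
    finally show ?thesis by (simp add: algebra_simps)
  qed
  from ell2_finite_sums_bound[OF this] show "u \<in> ell2"
    "sqnorm u \<le> 2 * (2 * real M + 1)\<^sup>2 * (\<alpha>\<^sup>2 * sqnorm f + \<beta>\<^sup>2 * sqnorm g)" by auto
qed

lemma window_sum_0: "window_sum 0 u n = cmod (u n)"
  by (simp add: window_sum_def)

lemma window_sum_ge:
  assumes "\<bar>m - n\<bar> \<le> int M"
  shows "cmod (u m) \<le> window_sum M u n"
proof -
  have "cmod (u (n + (m - n))) \<le> window_sum M u n"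
    unfolding window_sum_def by (rule member_le_sum) (use assms in auto)
  then show ?thesis by simp
qed

lemma window_sum_ge_sum:
  assumes "finite F" "\<And>m. m \<in> F \<Longrightarrow> \<bar>m - n\<bar> \<le> int M"
  shows "(\<Sum>m\<in>F. cmod (u m)) \<le> window_sum M u n"
proof -
  have "(\<Sum>m\<in>F. cmod (u m)) = (\<Sum>m\<in>(\<lambda>m. m - n) ` F. cmod (u (n + m)))"
    by (subst sum.reindex) (auto simp: inj_on_def)
  also have "\<dots> \<le> window_sum M u n"
    unfolding window_sum_def by (rule sum_mono2) (use assms in force)+
  finally show ?thesis .
qed

lemma ell2_lincomb:
  assumes "u \<in> ell2" "w \<in> ell2"
  shows "(\<lambda>n. a * u n + b * w n) \<in> ell2"
    and "sqnorm (\<lambda>n. a * u n + b * w n) \<le> 2 * ((cmod a)\<^sup>2 * sqnorm u + (cmod b)\<^sup>2 * sqnorm w)"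
proof -
  have "cmod (a * u n + b * w n) \<le> cmod a * window_sum 0 u n + cmod b * window_sum 0 w n" for n
    unfolding window_sum_0 norm_mult[symmetric] by (rule norm_triangle_ineq)
  from ell2_window_bound[OF assms this] show "(\<lambda>n. a * u n + b * w n) \<in> ell2"
    "sqnorm (\<lambda>n. a * u n + b * w n) \<le> 2 * ((cmod a)\<^sup>2 * sqnorm u + (cmod b)\<^sup>2 * sqnorm w)"
    by auto
qed

lemma ell2_diff:
  assumes "u \<in> ell2" "w \<in> ell2"
  shows "(\<lambda>n. u n - w n) \<in> ell2"
  using ell2_lincomb(1)[OF assms, of 1 "-1"] by simp

lemma ell2_zero: "(\<lambda>n. 0) \<in> ell2"
  by (simp add: ell2_def)

lemma sqnorm_eq_0D:
  assumes "u \<in> ell2" "sqnorm u \<le> 0"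
  shows "u n = 0"
  using cmod_le_sqrt_sqnorm[OF assms(1), of n] assms(2) sqnorm_nonneg[of u]
  by (simp add: order_antisym)

text \<open>
  The real part of the Hermitian inner product, which is all that the expansion of
  \<open>\<parallel>u - t w\<parallel>\<^sup>2\<close> for real \<open>t\<close> involves.
\<close>

definition ell2_inner :: "(int \<Rightarrow> complex) \<Rightarrow> (int \<Rightarrow> complex) \<Rightarrow> real" where
  "ell2_inner u w = (\<Sum>\<^sub>\<infinity>n. u n \<bullet> w n)"

lemma ell2_inner_summable:
  assumes "u \<in> ell2" "w \<in> ell2"
  shows "(\<lambda>n. u n \<bullet> w n) summable_on UNIV"
proof -
  have s: "(\<lambda>n. (cmod (u n))\<^sup>2 + (cmod (w n))\<^sup>2) summable_on UNIV"
    using assms by (intro summable_on_add) (auto simp: ell2_def)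
  have "\<bar>u n \<bullet> w n\<bar> \<le> (cmod (u n))\<^sup>2 + (cmod (w n))\<^sup>2" for n
  proof -
    have "\<bar>u n \<bullet> w n\<bar> \<le> cmod (u n) * cmod (w n)" by (rule Cauchy_Schwarz_ineq2)
    also have "\<dots> \<le> (cmod (u n))\<^sup>2 + (cmod (w n))\<^sup>2"
      using sum_squares_bound[of "cmod (u n)" "cmod (w n)"]
        mult_nonneg_nonneg[OF norm_ge_zero norm_ge_zero, of "u n" "w n"]
      by (simp only: mult.assoc)
    finally show ?thesis .
  qed
  then have "(\<lambda>n. norm (u n \<bullet> w n)) summable_on UNIV"
    by (intro summable_on_comparison_test[OF s]) auto
  then show ?thesis by (rule abs_summable_summable)
qed

lemma sqnorm_diff:
  assumes "u \<in> ell2" "w \<in> ell2"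
  shows "sqnorm (\<lambda>n. u n - of_real t * w n) = sqnorm u - 2 * t * ell2_inner u w + t\<^sup>2 * sqnorm w"
proof -
  have eq: "(cmod (u n - of_real t * w n))\<^sup>2
      = (cmod (u n))\<^sup>2 + ((- 2 * t) * (u n \<bullet> w n) + t\<^sup>2 * (cmod (w n))\<^sup>2)" for n
    unfolding scaleR_conv_of_real[symmetric] power2_norm_eq_inner
    by (simp add: inner_diff inner_commute power2_eq_square algebra_simps)
  have su: "(\<lambda>n. (cmod (u n))\<^sup>2) summable_on UNIV" and sw: "(\<lambda>n. (cmod (w n))\<^sup>2) summable_on UNIV"
    using assms by (auto simp: ell2_def)
  have s1: "(\<lambda>n. (- 2 * t) * (u n \<bullet> w n)) summable_on UNIV"
    and s2: "(\<lambda>n. t\<^sup>2 * (cmod (w n))\<^sup>2) summable_on UNIV"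
    by (intro summable_on_cmult_right ell2_inner_summable assms sw)+
  show ?thesis
    unfolding sqnorm_def ell2_inner_def eq infsum_add[OF su summable_on_add[OF s1 s2]]
      infsum_add[OF s1 s2] infsum_cmult_right' by simp
qed

lemma ell2_shift:
  assumes "u \<in> ell2"
  shows "(\<lambda>n. u (n + j)) \<in> ell2"
proof -
  have "cmod (u (n + j)) \<le> 1 * window_sum (nat \<bar>j\<bar>) u n + 0 * window_sum (nat \<bar>j\<bar>) u n" for n
    using window_sum_ge[of "n + j" n "nat \<bar>j\<bar>" u] by simp
  from ell2_window_bound(1)[OF assms assms this] show ?thesis .
qed

section \<open>Jacobi operators\<close>

definition jacobi :: "(int \<Rightarrow> real) \<Rightarrow> (int \<Rightarrow> complex) \<Rightarrow> (int \<Rightarrow> complex)" where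
  "jacobi V u = (\<lambda>n. u (n + 1) + u (n - 1) + of_real (V n) * u n)"

lemma jacobi_linear:
  "jacobi V (\<lambda>n. a * u n + b * w n) = (\<lambda>n. a * jacobi V u n + b * jacobi V w n)"
  by (simp add: jacobi_def algebra_simps)

lemma jacobi_diff: "jacobi V (\<lambda>n. u n - w n) = (\<lambda>n. jacobi V u n - jacobi V w n)"
  by (simp add: jacobi_def algebra_simps)

lemma jacobi_bounded:
  assumes V: "\<And>n. \<bar>V n\<bar> \<le> B" and u: "u \<in> ell2"
  shows "jacobi V u \<in> ell2" "sqnorm (jacobi V u) \<le> 18 * (1 + B)\<^sup>2 * sqnorm u"
proof -
  have B: "0 \<le> B" using V[of 0] by linarith
  have "cmod (jacobi V u n) \<le> (1 + B) * window_sum 1 u n + 0 * window_sum 1 u n" for n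
  proof -
    have set: "{-1..1::int} = {-1, 0, 1}" by auto
    have w: "window_sum 1 u n = cmod (u (n - 1)) + cmod (u n) + cmod (u (n + 1))"
      by (simp add: window_sum_def set)
    have "cmod (jacobi V u n) \<le> cmod (u (n + 1)) + cmod (u (n - 1)) + \<bar>V n\<bar> * cmod (u n)"
      unfolding jacobi_def
      using norm_triangle_ineq[of "u (n + 1) + u (n - 1)" "of_real (V n) * u n"]
        norm_triangle_ineq[of "u (n + 1)" "u (n - 1)"] by (simp add: norm_mult)
    also have "\<dots> \<le> cmod (u (n + 1)) + cmod (u (n - 1)) + B * cmod (u n)"
      using V by (intro add_mono mult_right_mono) auto
    also have "\<dots> \<le> (1 + B) * window_sum 1 u n"
      using B unfolding w by (simp add: algebra_simps)
    finally show ?thesis by simp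
  qed
  from ell2_window_bound[OF u u this] show "jacobi V u \<in> ell2"
    "sqnorm (jacobi V u) \<le> 18 * (1 + B)\<^sup>2 * sqnorm u"
    by auto
qed

text \<open>
  The two translations are adjoint to each other, and the potential is real.
\<close>

lemma jacobi_symmetric:
  assumes V: "\<And>n. \<bar>V n\<bar> \<le> B" and u: "u \<in> ell2" and w: "w \<in> ell2"
  shows "ell2_inner u (jacobi V w) = ell2_inner (jacobi V u) w"
proof -
  have shift: "ell2_inner (\<lambda>n. f (n + 1)) g = ell2_inner f (\<lambda>n. g (n - 1))" for f g
  proof -
    have b: "bij_betw (\<lambda>n::int. n + 1) UNIV UNIV"
      by (rule bij_betwI[of _ _ _ "\<lambda>n. n - 1"]) auto
    show ?thesis
      unfolding ell2_inner_def
      using infsum_reindex_bij_betw[OF b, of "\<lambda>n. f n \<bullet> g (n - 1)"] by simp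
  qed
  have split: "ell2_inner (\<lambda>n. p n + q n + r n) s = ell2_inner p s + ell2_inner q s + ell2_inner r s"
    if "p \<in> ell2" "q \<in> ell2" "r \<in> ell2" "s \<in> ell2" for p q r s
    unfolding ell2_inner_def
    by (simp add: inner_add_left infsum_add summable_on_add ell2_inner_summable that)
  have comm: "ell2_inner p q = ell2_inner q p" for p q
    by (simp add: ell2_inner_def inner_commute)
  have diag: "(\<lambda>n. of_real (V n) * p n) \<in> ell2" if p: "p \<in> ell2" for p
  proof -
    have "cmod (of_real (V n) * p n) \<le> B * window_sum 0 p n + 0 * window_sum 0 p n" for n
      using mult_right_mono[OF V[of n], of "cmod (p n)"] by (simp add: norm_mult window_sum_0)
    from ell2_window_bound(1)[OF p p this] show ?thesis .
  qed
  have m: "(\<lambda>n. p (n - 1)) \<in> ell2" if "p \<in> ell2" for p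
    using ell2_shift[OF that, of "-1"] by simp
  have d: "ell2_inner u (\<lambda>n. of_real (V n) * w n) = ell2_inner (\<lambda>n. of_real (V n) * u n) w"
    unfolding ell2_inner_def by (simp add: scaleR_conv_of_real[symmetric])
  have "ell2_inner u (jacobi V w) = ell2_inner u (\<lambda>n. w (n + 1)) + ell2_inner u (\<lambda>n. w (n - 1))
      + ell2_inner u (\<lambda>n. of_real (V n) * w n)"
    unfolding jacobi_def comm[of u] using u w by (simp add: split ell2_shift m diag)
  also have "\<dots> = ell2_inner (\<lambda>n. u (n - 1)) w + ell2_inner (\<lambda>n. u (n + 1)) w
      + ell2_inner (\<lambda>n. of_real (V n) * u n) w"
    using shift[of w u] shift[of u w] d by (simp add: comm)
  also have "\<dots> = ell2_inner (jacobi V u) w"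
    unfolding jacobi_def using u w by (simp add: split ell2_shift m diag)
  finally show ?thesis .
qed

section \<open>Inversion of Jacobi operators that are bounded below\<close>

text \<open>
  A gradient step for the functional \<open>\<parallel>J u\<parallel>\<^sup>2 / 2\<close>. Since \<open>J\<close> is symmetric,
  \<open>\<langle>u, J J u\<rangle> = \<parallel>J u\<parallel>\<^sup>2\<close>, and with \<open>t = 1 / M\<close>, where \<open>\<parallel>J\<parallel>\<^sup>2 \<le> M\<close>,
  the quadratic term \<open>t\<^sup>2 \<parallel>J J u\<parallel>\<^sup>2\<close> eats up at most half of the linear term
  \<open>2 t \<parallel>J u\<parallel>\<^sup>2\<close>. Thus \<open>1 - t J\<^sup>2\<close> is a contraction as soon as \<open>J\<close> is bounded
  below.
\<close>

lemma jacobi_richardson_contraction: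
  assumes V: "\<And>n. \<bar>V n\<bar> \<le> B" and M: "M = 18 * (1 + B)\<^sup>2" and u: "u \<in> ell2"
    and low: "c * sqnorm u \<le> sqnorm (jacobi V u)"
  shows "sqnorm (\<lambda>n. u n - of_real (1 / M) * jacobi V (jacobi V u) n) \<le> (1 - c / M) * sqnorm u"
proof -
  have "0 \<le> B" using V[of 0] by linarith
  then have Mpos: "0 < M" by (simp add: M)
  let ?g = "jacobi V u"
  let ?h = "jacobi V ?g"
  have g: "?g \<in> ell2" using jacobi_bounded(1)[OF V u] .
  have h: "?h \<in> ell2" and hM: "sqnorm ?h \<le> M * sqnorm ?g"
    using jacobi_bounded[OF V g] by (simp_all add: M)
  have inner: "ell2_inner u ?h = sqnorm ?g"
    using jacobi_symmetric[OF V u g]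
    by (simp add: ell2_inner_def sqnorm_def power2_norm_eq_inner)
  have "sqnorm (\<lambda>n. u n - of_real (1 / M) * ?h n)
      = sqnorm u - 2 * (1 / M) * sqnorm ?g + (1 / M)\<^sup>2 * sqnorm ?h"
    using sqnorm_diff[OF u h, of "1 / M"] unfolding inner .
  also have "(1 / M)\<^sup>2 * sqnorm ?h \<le> (1 / M)\<^sup>2 * (M * sqnorm ?g)"
    using hM by (intro mult_left_mono) auto
  also have "(1 / M)\<^sup>2 * (M * sqnorm ?g) = (1 / M) * sqnorm ?g"
    using Mpos by (simp add: power2_eq_square)
  finally have "sqnorm (\<lambda>n. u n - of_real (1 / M) * ?h n) \<le> sqnorm u - (1 / M) * sqnorm ?g"
    by simp
  also have "\<dots> \<le> sqnorm u - (1 / M) * (c * sqnorm u)"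
    using low Mpos by (intro diff_left_mono mult_left_mono) auto
  finally show ?thesis by (simp add: algebra_simps)
qed

text \<open>
  The part of the completeness of \<open>\<ell>\<^sup>2\<close> that a geometrically convergent iteration uses. It
  suffices to identify the limit pointwise, because Jacobi operators are local.
\<close>

lemma ell2_geometric_series:
  fixes d :: "nat \<Rightarrow> int \<Rightarrow> complex"
  assumes d: "\<And>k. d k \<in> ell2" and bound: "\<And>k. sqnorm (d k) \<le> q ^ k * D" and q: "0 \<le> q" "q < 1"
  obtains u where "u \<in> ell2" "\<And>j. (\<lambda>k. \<Sum>i<k. d i j) \<longlonglongrightarrow> u j"
proof -
  define r where "r = sqrt q"
  have r: "0 \<le> r" "r < 1" using q by (auto simp: r_def)
  have sqrt_bound: "sqrt (sqnorm (d k)) \<le> sqrt D * r ^ k" for k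
    using bound[of k] unfolding r_def real_sqrt_power[symmetric] real_sqrt_mult[symmetric]
    by (simp add: mult.commute)
  have geo: "summable (\<lambda>k. sqrt D * r ^ k)"
    using r by (intro summable_mult summable_geometric) auto
  have D: "0 \<le> sqrt D"
    using order_trans[OF sqnorm_nonneg bound[of 0]] by simp
  define u where "u j = (\<Sum>k. d k j)" for j
  have summ: "summable (\<lambda>k. d k j)" for j
    using order_trans[OF cmod_le_sqrt_sqnorm[OF d] sqrt_bound] by (intro summable_comparison_test'[OF geo])
  then have lim: "(\<lambda>k. \<Sum>i<k. d i j) \<longlonglongrightarrow> u j" for j
    unfolding u_def by (rule summable_LIMSEQ)
  define b where "b = (\<Sum>k. sqrt D * r ^ k)"
  have partial: "L2_set (\<lambda>j. cmod (\<Sum>i<k. d i j)) F \<le> (\<Sum>i<k. sqrt D * r ^ i)" if "finite F" for F k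
  proof (induction k)
    case (Suc k)
    have "L2_set (\<lambda>j. cmod (\<Sum>i<Suc k. d i j)) F
        \<le> L2_set (\<lambda>j. cmod (\<Sum>i<k. d i j) + cmod (d k j)) F"
      by (intro L2_set_mono) (simp_all add: norm_triangle_ineq)
    also have "\<dots> \<le> L2_set (\<lambda>j. cmod (\<Sum>i<k. d i j)) F + L2_set (\<lambda>j. cmod (d k j)) F"
      by (rule L2_set_triangle_ineq)
    also have "L2_set (\<lambda>j. cmod (d k j)) F \<le> sqrt D * r ^ k"
      unfolding L2_set_def
      using finite_sum_le_sqnorm[OF d that] sqrt_bound[of k] by (meson order_trans real_sqrt_le_mono)
    finally show ?case using Suc by simp
  qed (simp add: L2_set_def)
  have "(\<Sum>j\<in>F. (cmod (u j))\<^sup>2) \<le> b\<^sup>2" if F: "finite F" for F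
  proof (rule LIMSEQ_le_const2)
    show "(\<lambda>k. \<Sum>j\<in>F. (cmod (\<Sum>i<k. d i j))\<^sup>2) \<longlonglongrightarrow> (\<Sum>j\<in>F. (cmod (u j))\<^sup>2)"
      by (intro tendsto_intros lim)
    have "(\<Sum>j\<in>F. (cmod (\<Sum>i<k. d i j))\<^sup>2) \<le> b\<^sup>2" for k
    proof -
      have "L2_set (\<lambda>j. cmod (\<Sum>i<k. d i j)) F \<le> b"
        unfolding b_def using partial[OF F, of k] sum_le_suminf[OF geo, of "{..<k}"] r D
        by (meson finite_lessThan mult_nonneg_nonneg order_trans zero_le_power)
      then have "(L2_set (\<lambda>j. cmod (\<Sum>i<k. d i j)) F)\<^sup>2 \<le> b\<^sup>2"
        by (intro power_mono) (auto simp: L2_set_nonneg)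
      then show ?thesis by (simp add: L2_set_def sum_nonneg)
    qed
    then show "\<exists>N. \<forall>k\<ge>N. (\<Sum>j\<in>F. (cmod (\<Sum>i<k. d i j))\<^sup>2) \<le> b\<^sup>2" by blast
  qed
  then have "u \<in> ell2" by (rule ell2_finite_sums_bound(1))
  with lim show ?thesis using that by blast
qed

text \<open>
  The iteration \<open>u \<mapsto> u - t J (J u - f)\<close> has a pointwise limit \<open>u\<close> in \<open>\<ell>\<^sup>2\<close>.
  There \<open>J (J u - f) = 0\<close>, and the lower bound, applied to \<open>J u - f\<close> itself, yields
  \<open>J u = f\<close>.
\<close>

lemma jacobi_surj_if_bounded_below:
  assumes V: "\<And>n. \<bar>V n\<bar> \<le> B" and c: "0 < c"
    and low: "\<And>u. u \<in> ell2 \<Longrightarrow> c * sqnorm u \<le> sqnorm (jacobi V u)" and f: "f \<in> ell2"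
  obtains u where "u \<in> ell2" "jacobi V u = f"
proof -
  define M where "M = 18 * (1 + B)\<^sup>2"
  have "0 \<le> B" using V[of 0] by linarith
  then have M: "0 < M" by (simp add: M_def)
  define t :: complex where "t = of_real (1 / M)"
  define q where "q = max 0 (1 - c / M)"
  have q: "0 \<le> q" "q < 1" using c M by (auto simp: q_def)
  define T where "T u = (\<lambda>n. u n - t * jacobi V (\<lambda>n. jacobi V u n - f n) n)" for u
  define x where "x k = (T ^^ k) (\<lambda>_. 0)" for k
  define d where "d k = (\<lambda>n. x (Suc k) n - x k n)" for k
  have J: "jacobi V u \<in> ell2" if "u \<in> ell2" for u
    using jacobi_bounded(1)[OF V that] .
  have T: "T u \<in> ell2" if "u \<in> ell2" for u
    using ell2_lincomb(1)[OF that J[OF ell2_diff[OF J[OF that] f]], of 1 "- t"] by (simp add: T_def)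
  have x: "x k \<in> ell2" for k
    by (induction k) (auto simp: x_def ell2_zero T)
  have d: "d k \<in> ell2" for k
    unfolding d_def by (intro ell2_diff x)
  have d_Suc: "d (Suc k) = (\<lambda>n. d k n - of_real (1 / M) * jacobi V (jacobi V (d k)) n)" for k
  proof -
    have "d (Suc k) = (\<lambda>n. T (x (Suc k)) n - T (x k) n)"
      by (simp add: d_def x_def)
    then show ?thesis
      by (simp add: T_def d_def jacobi_diff t_def right_diff_distrib fun_eq_iff)
  qed
  have bound: "sqnorm (d k) \<le> q ^ k * sqnorm (d 0)" for k
  proof (induction k)
    case (Suc k)
    have "sqnorm (d (Suc k)) \<le> (1 - c / M) * sqnorm (d k)"
      unfolding d_Suc by (rule jacobi_richardson_contraction[OF V M_def d low[OF d]])
    also have "\<dots> \<le> q * sqnorm (d k)"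
      by (intro mult_right_mono) (auto simp: q_def)
    also have "\<dots> \<le> q * (q ^ k * sqnorm (d 0))"
      using Suc q by (intro mult_left_mono) auto
    finally show ?case by simp
  qed simp
  obtain u where u: "u \<in> ell2" and lim: "\<And>j. (\<lambda>k. \<Sum>i<k. d i j) \<longlonglongrightarrow> u j"
    using ell2_geometric_series[OF d bound q] by blast
  have "(\<Sum>i<k. d i j) = x k j" for k j
    unfolding d_def by (subst sum_lessThan_telescope) (simp add: x_def)
  then have xlim: "(\<lambda>k. x k j) \<longlonglongrightarrow> u j" for j
    using lim[of j] by simp
  have fixed: "T u j = u j" for j
  proof (rule LIMSEQ_unique)
    show "(\<lambda>k. T (x k) j) \<longlonglongrightarrow> T u j"
      unfolding T_def jacobi_def by (intro tendsto_intros xlim)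
    have "(\<lambda>k. x (Suc k) j) \<longlonglongrightarrow> u j"
      using xlim[of j] by (rule LIMSEQ_Suc)
    then show "(\<lambda>k. T (x k) j) \<longlonglongrightarrow> u j"
      by (simp add: x_def)
  qed
  define g where "g = (\<lambda>n. jacobi V u n - f n)"
  have g: "g \<in> ell2"
    unfolding g_def using J[OF u] f by (rule ell2_diff)
  have "t \<noteq> 0" using M by (simp add: t_def)
  then have "jacobi V g = (\<lambda>n. 0)"
    using fixed by (simp add: T_def g_def fun_eq_iff)
  then have "c * sqnorm g \<le> 0"
    using low[OF g] by (simp add: sqnorm_def)
  then have "sqnorm g \<le> 0" using c by (simp add: mult_le_0_iff)
  then have "jacobi V u = f"
    using sqnorm_eq_0D[OF g] by (simp add: g_def fun_eq_iff)
  with u show ?thesis using that by blast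
qed

text \<open>
  Finitely supported sequences are dense. The factor \<open>4\<close> comes from using
  \<open>\<parallel>a + b\<parallel>\<^sup>2 \<le> 2 \<parallel>a\<parallel>\<^sup>2 + 2 \<parallel>b\<parallel>\<^sup>2\<close> twice.
\<close>

lemma jacobi_finite_support_bound:
  assumes V: "\<And>n. \<bar>V n\<bar> \<le> B" and K: "0 \<le> K"
    and fin: "\<And>u. finite {n. u n \<noteq> 0} \<Longrightarrow> sqnorm u \<le> K * sqnorm (jacobi V u)"
    and u: "u \<in> ell2"
  shows "sqnorm u \<le> 4 * K * sqnorm (jacobi V u)"
proof (rule field_le_epsilon)
  fix e :: real assume e: "0 < e"
  define M where "M = 18 * (1 + B)\<^sup>2"
  have "0 \<le> M" by (simp add: M_def)
  define \<epsilon> where "\<epsilon> = e / (4 * K * M + 2)"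
  have pos: "0 < 4 * K * M + 2"
    using K \<open>0 \<le> M\<close> by (simp add: add_nonneg_pos)
  then have \<epsilon>: "0 < \<epsilon>" using e by (simp add: \<epsilon>_def)
  have "((\<lambda>n. (cmod (u n))\<^sup>2) has_sum sqnorm u) UNIV"
    using u by (simp add: ell2_def sqnorm_def)
  from has_sum_finite_approximation[OF this \<epsilon>] obtain F where F: "finite F"
    and approx: "dist (\<Sum>n\<in>F. (cmod (u n))\<^sup>2) (sqnorm u) \<le> \<epsilon>" by blast
  \<comment> \<open>The finitely supported main part of \<open>u\<close> and a remainder of square norm at most \<open>\<epsilon>\<close>.\<close>
  define p where "p n = (if n \<in> F then u n else 0)" for n
  define r where "r n = (if n \<in> F then 0 else u n)" for n
  have fin_p: "finite {n. p n \<noteq> 0}"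
    using F by (rule rev_finite_subset) (auto simp: p_def)
  have "(\<Sum>n\<in>G. (cmod (r n))\<^sup>2) \<le> \<epsilon>" if G: "finite G" for G
  proof -
    have "(\<Sum>n\<in>G. (cmod (r n))\<^sup>2) = (\<Sum>n\<in>G - F. (cmod (u n))\<^sup>2)"
      by (rule sum.mono_neutral_cong_right) (auto simp: G r_def)
    also have "\<dots> = (\<Sum>n\<in>F \<union> (G - F). (cmod (u n))\<^sup>2) - (\<Sum>n\<in>F. (cmod (u n))\<^sup>2)"
      using F G by (subst sum.union_disjoint) auto
    also have "\<dots> \<le> sqnorm u - (\<Sum>n\<in>F. (cmod (u n))\<^sup>2)"
      using finite_sum_le_sqnorm[OF u, of "F \<union> (G - F)"] F G by simp
    also have "\<dots> \<le> \<epsilon>"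
      using approx by (simp add: dist_real_def)
    finally show ?thesis .
  qed
  from ell2_finite_sums_bound[OF this] have r: "r \<in> ell2" "sqnorm r \<le> \<epsilon>"
    by auto
  have p: "p \<in> ell2"
    using fin_p by (rule ell2_finite_support)
  have J: "jacobi V w \<in> ell2" if "w \<in> ell2" for w
    using jacobi_bounded(1)[OF V that] .
  have "u = (\<lambda>n. 1 * p n + 1 * r n)"
    by (auto simp: p_def r_def)
  then have "sqnorm u \<le> 2 * (sqnorm p + sqnorm r)"
    using ell2_lincomb(2)[OF p r(1), of 1 1] by simp
  also have "sqnorm p \<le> K * sqnorm (jacobi V p)"
    using fin[OF fin_p] .
  also have "jacobi V p = (\<lambda>n. 1 * jacobi V u n + (-1) * jacobi V r n)"
  proof -
    have "p = (\<lambda>n. u n - r n)" by (auto simp: p_def r_def)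
    then show ?thesis by (simp add: jacobi_diff)
  qed
  also have "K * sqnorm (\<lambda>n. 1 * jacobi V u n + (-1) * jacobi V r n)
      \<le> K * (2 * (sqnorm (jacobi V u) + M * \<epsilon>))"
  proof (intro mult_left_mono[OF _ K])
    have "sqnorm (jacobi V r) \<le> M * sqnorm r"
      unfolding M_def using jacobi_bounded(2)[OF V r(1)] .
    also have "\<dots> \<le> M * \<epsilon>" using r(2) \<open>0 \<le> M\<close> by (rule mult_left_mono)
    finally show "sqnorm (\<lambda>n. 1 * jacobi V u n + (-1) * jacobi V r n) \<le> 2 * (sqnorm (jacobi V u) + M * \<epsilon>)"
      using ell2_lincomb(2)[OF J[OF u] J[OF r(1)], of 1 "-1"] by simp
  qed
  also have "2 * (K * (2 * (sqnorm (jacobi V u) + M * \<epsilon>)) + sqnorm r)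
      \<le> 4 * K * sqnorm (jacobi V u) + (4 * K * M + 2) * \<epsilon>"
    using r(2) by (simp add: algebra_simps)
  also have "(4 * K * M + 2) * \<epsilon> = e"
    using pos by (simp add: \<epsilon>_def)
  finally show "sqnorm u \<le> 4 * K * sqnorm (jacobi V u) + e" by simp
qed

lemma schroedinger_diff_eq_jacobi:
  "(\<lambda>n. schroedinger w \<omega> u n - of_real E * u n) = jacobi (\<lambda>n. w (\<omega> n) - E) u"
  by (simp add: schroedinger_def jacobi_def algebra_simps)

text \<open>
  A real number lies outside the spectrum of a self-adjoint operator if and only if the
  shifted operator is bounded below. Only finitely supported test sequences occur here: they
  see a finite piece of \<open>\<omega>\<close>, which makes the criterion comparable between points of a
  minimal subshift.
\<close>

lemma notin_spectrum_iff_bounded_below: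
  assumes w: "\<And>n. \<bar>w (\<omega> n)\<bar> \<le> B"
  shows "complex_of_real E \<notin> spectrum (schroedinger w \<omega>) \<longleftrightarrow>
    (\<exists>K\<ge>0. \<forall>u. finite {n. u n \<noteq> 0} \<longrightarrow> sqnorm u \<le> K * sqnorm (jacobi (\<lambda>n. w (\<omega> n) - E) u))"
    (is "_ \<longleftrightarrow> (\<exists>K\<ge>0. ?P K)")
proof -
  let ?V = "\<lambda>n. w (\<omega> n) - E"
  have V: "\<bar>?V n\<bar> \<le> B + \<bar>E\<bar>" for n
    using w[of n] by linarith
  have J: "jacobi ?V u \<in> ell2" if "u \<in> ell2" for u
    using jacobi_bounded(1)[OF V that] .
  have spec: "complex_of_real E \<notin> spectrum (schroedinger w \<omega>) \<longleftrightarrow>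
    (\<exists>R. bounded_operator R \<and> (\<forall>u\<in>ell2. R (jacobi ?V u) = u) \<and> (\<forall>u\<in>ell2. jacobi ?V (R u) = u))"
    unfolding spectrum_def mem_Collect_eq schroedinger_diff_eq_jacobi by (rule not_not)
  show ?thesis
  proof
    assume "complex_of_real E \<notin> spectrum (schroedinger w \<omega>)"
    then obtain R where R: "bounded_operator R" "\<forall>u\<in>ell2. R (jacobi ?V u) = u"
      unfolding spec by blast
    then obtain K where K: "\<And>g. g \<in> ell2 \<Longrightarrow> sqrt (sqnorm (R g)) \<le> K * sqrt (sqnorm g)"
      unfolding bounded_operator_def ell2_norm_eq_sqrt_sqnorm by blast
    have "sqnorm u \<le> K\<^sup>2 * sqnorm (jacobi ?V u)" if "finite {n. u n \<noteq> 0}" for u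
    proof -
      have u: "u \<in> ell2" using that by (rule ell2_finite_support)
      have "sqrt (sqnorm u) \<le> K * sqrt (sqnorm (jacobi ?V u))"
        using K[OF J[OF u]] R(2) u by simp
      then have "(sqrt (sqnorm u))\<^sup>2 \<le> (K * sqrt (sqnorm (jacobi ?V u)))\<^sup>2"
        by (intro power_mono) auto
      then show ?thesis by (simp add: power_mult_distrib)
    qed
    then show "\<exists>K\<ge>0. ?P K" by (intro exI[of _ "K\<^sup>2"]) auto
  next
    assume "\<exists>K\<ge>0. ?P K"
    then obtain K where K: "0 \<le> K" "?P K" by blast
    \<comment> \<open>The summand \<open>1\<close> covers the case \<open>K = 0\<close>.\<close>
    define c where "c = 1 / (4 * K + 1)"
    have c: "0 < c" using K by (simp add: c_def)
    have low: "c * sqnorm u \<le> sqnorm (jacobi ?V u)" if "u \<in> ell2" for u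
    proof -
      have "sqnorm u \<le> 4 * K * sqnorm (jacobi ?V u)"
        by (rule jacobi_finite_support_bound[OF V K(1) K(2)[rule_format] that])
      also have "\<dots> \<le> (4 * K + 1) * sqnorm (jacobi ?V u)"
        by (intro mult_right_mono) auto
      finally show ?thesis
        using K by (simp add: c_def field_simps)
    qed
    have inj: "u = u'" if "u \<in> ell2" "u' \<in> ell2" "jacobi ?V u = jacobi ?V u'" for u u'
    proof -
      have d: "(\<lambda>n. u n - u' n) \<in> ell2" using that by (intro ell2_diff)
      have "jacobi ?V (\<lambda>n. u n - u' n) = (\<lambda>n. 0)"
        using that(3) by (simp add: jacobi_diff)
      then have "c * sqnorm (\<lambda>n. u n - u' n) \<le> 0"
        using low[OF d] by (simp add: sqnorm_def)
      then have "sqnorm (\<lambda>n. u n - u' n) \<le> 0"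
        using c by (simp add: mult_le_0_iff)
      from sqnorm_eq_0D[OF d this] show ?thesis by (simp add: fun_eq_iff)
    qed
    have "\<exists>u. u \<in> ell2 \<and> jacobi ?V u = f" if "f \<in> ell2" for f
      using jacobi_surj_if_bounded_below[OF V c low that] by blast
    then obtain R where R: "\<And>f. f \<in> ell2 \<Longrightarrow> R f \<in> ell2 \<and> jacobi ?V (R f) = f"
      by metis
    have R_eqI: "R f = u" if "u \<in> ell2" "jacobi ?V u = f" for f u
      using that R J inj by metis
    have lin: "R (\<lambda>n. a * f n + b * g n) = (\<lambda>n. a * R f n + b * R g n)"
      if "f \<in> ell2" "g \<in> ell2" for a b f g
      using R[OF that(1)] R[OF that(2)] by (intro R_eqI ell2_lincomb) (auto simp: jacobi_linear)
    have "bounded_operator R"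
      unfolding bounded_operator_def
    proof (intro conjI ballI allI exI)
      show "R ` ell2 \<subseteq> ell2" using R by auto
      show "R (\<lambda>n. f n + g n) = (\<lambda>n. R f n + R g n)" if "f \<in> ell2" "g \<in> ell2" for f g
        using lin[OF that, of 1 1] by simp
      show "R (\<lambda>n. a * f n) = (\<lambda>n. a * R f n)" if "f \<in> ell2" for a f
        using lin[OF that that, of a 0] by simp
      show "ell2_norm (R f) \<le> sqrt (1 / c) * ell2_norm f" if "f \<in> ell2" for f
      proof -
        have "sqnorm (R f) \<le> (1 / c) * sqnorm f"
          using low[of "R f"] R[OF that] c by (simp add: field_simps)
        then show ?thesis
          unfolding ell2_norm_eq_sqrt_sqnorm real_sqrt_mult[symmetric] by (rule real_sqrt_le_mono)
      qed
    qed
    then show "complex_of_real E \<notin> spectrum (schroedinger w \<omega>)"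
      unfolding spec using R R_eqI by blast
  qed
qed

section \<open>Minimal subshifts\<close>

lemma subshift_letters:
  assumes "subshift k \<Omega>" "\<omega> \<in> \<Omega>"
  shows "\<omega> n \<in> {1..k}"
proof -
  have "\<omega> \<in> topspace (full_shift k)"
    using assms compactin_subset_topspace by (auto simp: subshift_def)
  then show ?thesis by (auto simp: full_shift_def PiE_iff)
qed

lemma subshift_translate:
  assumes "subshift k \<Omega>" "\<omega> \<in> \<Omega>"
  shows "(\<lambda>n. \<omega> (n + j)) \<in> \<Omega>"
proof (induction j rule: int_induct[of _ 0])
  case base
  then show ?case using assms by simp
next
  case (step1 i)
  then have "shift (\<lambda>n. \<omega> (n + i)) \<in> \<Omega>"
    using assms(1) by (auto simp: subshift_def)
  then show ?case by (simp add: shift_def algebra_simps)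
next
  case (step2 i)
  then obtain \<eta> where \<eta>: "\<eta> \<in> \<Omega>" "(\<lambda>n. \<omega> (n + i)) = shift \<eta>"
    using assms(1) unfolding subshift_def by blast
  have "\<eta> n = \<omega> (n + (i - 1))" for n
    using fun_cong[OF \<eta>(2), of "n - 1"] by (simp add: shift_def algebra_simps)
  then have "\<eta> = (\<lambda>n. \<omega> (n + (i - 1)))" by blast
  with \<eta>(1) show ?case by simp
qed

lemma openin_full_shift_cylinder:
  assumes "finite F" "\<And>n. n \<in> F \<Longrightarrow> \<eta> n \<in> {1..k}"
  shows "openin (full_shift k) (\<Pi>\<^sub>E n\<in>UNIV. if n \<in> F then {\<eta> n} else {1..k})"
proof -
  have "{n. (if n \<in> F then {\<eta> n} else {1..k}) \<noteq> {1..k}} \<subseteq> F" by auto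
  then have "finite {n. (if n \<in> F then {\<eta> n} else {1..k}) \<noteq> {1..k}}"
    using assms(1) by (rule finite_subset)
  then show ?thesis
    unfolding full_shift_def using assms(2) by (intro product_topology_basis) auto
qed

lemma minimal_orbit_visits:
  assumes "minimal_subshift k \<Omega>" "\<omega> \<in> \<Omega>" "\<eta> \<in> \<Omega>" "finite F"
  obtains j where "\<And>n. n \<in> F \<Longrightarrow> \<omega> (n + j) = \<eta> n"
proof -
  have sub: "subshift k \<Omega>" using assms(1) by (simp add: minimal_subshift_def)
  let ?U = "\<Pi>\<^sub>E n\<in>UNIV. if n \<in> F then {\<eta> n} else {1..k}"
  have "openin (full_shift k) ?U"
    using subshift_letters[OF sub assms(3)] assms(4) by (intro openin_full_shift_cylinder)
  moreover have "\<eta> \<in> ?U"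
    using subshift_letters[OF sub assms(3)] by (auto simp: PiE_iff)
  moreover have "\<eta> \<in> full_shift k closure_of orbit \<omega>"
    using assms by (auto simp: minimal_subshift_def)
  ultimately obtain \<xi> where "\<xi> \<in> orbit \<omega>" "\<xi> \<in> ?U"
    unfolding in_closure_of by blast
  then obtain j where "(\<lambda>n. \<omega> (n + j)) \<in> ?U"
    by (auto simp: orbit_def)
  then have j: "\<omega> (n + j) \<in> (if n \<in> F then {\<eta> n} else {1..k})" for n
    by (simp only: PiE_iff UNIV_I simp_thms)
  have "\<omega> (n + j) = \<eta> n" if "n \<in> F" for n
    using j[of n] that by simp
  then show ?thesis using that by blast
qed

text \<open>
  The orbit of every point meets the open set of points with letter \<open>a\<close> at the origin. Hence
  the translates of this set cover \<open>\<Omega>\<close>, and finitely many translates suffice by compactness;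
  the largest of these translations bounds the gaps between occurrences of \<open>a\<close>.
\<close>

lemma minimal_letter_syndetic:
  assumes min: "minimal_subshift k \<Omega>" and a: "occurs a \<Omega>"
  obtains L where "\<And>\<omega> n. \<omega> \<in> \<Omega> \<Longrightarrow> \<exists>m\<in>{n - int L..n + int L}. \<omega> m = a"
proof -
  have sub: "subshift k \<Omega>" using min by (simp add: minimal_subshift_def)
  obtain \<eta> where \<eta>: "\<eta> \<in> \<Omega>" "\<eta> 0 = a" using a by (auto simp: occurs_def)
  have ak: "a \<in> {1..k}" using subshift_letters[OF sub \<eta>(1), of 0] \<eta>(2) by simp
  define U where "U j = (\<Pi>\<^sub>E n\<in>UNIV. if n \<in> {j} then {a} else {1..k})" for j :: int
  have U_D: "\<xi> j = a" if "\<xi> \<in> U j" for \<xi> j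
  proof -
    have "\<xi> j \<in> (if j \<in> {j} then {a} else {1..k})"
      using that unfolding U_def by (rule PiE_mem) simp
    then show ?thesis by simp
  qed
  have cover: "\<Omega> \<subseteq> \<Union> (range U)"
  proof
    fix \<omega> assume \<omega>: "\<omega> \<in> \<Omega>"
    obtain j where "\<omega> (0 + j) = \<eta> 0"
      using minimal_orbit_visits[OF min \<omega> \<eta>(1), of "{0}"] by auto
    then have "\<omega> \<in> U j"
      using \<eta>(2) subshift_letters[OF sub \<omega>] by (auto simp: U_def PiE_iff)
    then show "\<omega> \<in> \<Union> (range U)" by blast
  qed
  have "compactin (full_shift k) \<Omega>" using sub by (simp add: subshift_def)
  moreover have "openin (full_shift k) W" if "W \<in> range U" for W
    using that ak openin_full_shift_cylinder[of "{_}" "\<lambda>_. a" k] by (auto simp: U_def)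
  ultimately obtain \<F> where \<F>: "finite \<F>" "\<F> \<subseteq> range U" "\<Omega> \<subseteq> \<Union> \<F>"
    using compactinD[OF _ _ cover] by meson
  then obtain J where J: "finite J" "\<F> = U ` J"
    using finite_subset_image by meson
  obtain L where L: "\<And>j. j \<in> J \<Longrightarrow> \<bar>j\<bar> \<le> int L"
  proof
    fix j assume "j \<in> J"
    then have "nat \<bar>j\<bar> \<le> Max ((\<lambda>j. nat \<bar>j\<bar>) ` J)" using J(1) by (intro Max_ge) auto
    then show "\<bar>j\<bar> \<le> int (Max ((\<lambda>j. nat \<bar>j\<bar>) ` J))" by linarith
  qed
  have "\<exists>m\<in>{n - int L..n + int L}. \<omega> m = a" if \<omega>: "\<omega> \<in> \<Omega>" for \<omega> n
  proof -
    have "(\<lambda>i. \<omega> (i + n)) \<in> \<Omega>" using subshift_translate[OF sub \<omega>] .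
    then obtain j where j: "j \<in> J" "(\<lambda>i. \<omega> (i + n)) \<in> U j" using \<F>(3) J(2) by blast
    have "\<omega> (j + n) = a" using U_D[OF j(2)] .
    moreover have "j + n \<in> {n - int L..n + int L}" using L[OF j(1)] by auto
    ultimately show ?thesis by blast
  qed
  then show ?thesis using that by blast
qed

lemma sqnorm_shift: "sqnorm (\<lambda>n. u (n + j)) = sqnorm u"
proof -
  have "bij_betw (\<lambda>n::int. n + j) UNIV UNIV"
    by (rule bij_betwI[of _ _ _ "\<lambda>n. n - j"]) auto
  then show ?thesis
    unfolding sqnorm_def by (rule infsum_reindex_bij_betw[where f = "\<lambda>n. (cmod (u n))\<^sup>2"])
qed

text \<open>
  The values of \<open>\<eta>\<close> on the support of a test sequence reappear somewhere in \<open>\<omega>\<close>, so the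
  lower bound for \<open>\<omega>\<close>, tested on a translated sequence, is a lower bound for \<open>\<eta>\<close>.
\<close>

lemma minimal_spectrum_mono:
  assumes min: "minimal_subshift k \<Omega>" and \<omega>: "\<omega> \<in> \<Omega>" and \<eta>: "\<eta> \<in> \<Omega>"
    and E: "complex_of_real E \<notin> spectrum (schroedinger w \<omega>)"
  shows "complex_of_real E \<notin> spectrum (schroedinger w \<eta>)"
proof -
  have sub: "subshift k \<Omega>" using min by (simp add: minimal_subshift_def)
  have B: "\<bar>w (\<xi> n)\<bar> \<le> (\<Sum>a\<in>{1..k}. \<bar>w a\<bar>)" if "\<xi> \<in> \<Omega>" for \<xi> n
    by (rule member_le_sum[where f = "\<lambda>a. \<bar>w a\<bar>"])
      (use subshift_letters[OF sub that] in auto)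
  let ?J = "\<lambda>\<xi>. jacobi (\<lambda>n. w (\<xi> n) - E)"
  obtain K where K: "0 \<le> K" "\<And>u. finite {n. u n \<noteq> 0} \<Longrightarrow> sqnorm u \<le> K * sqnorm (?J \<omega> u)"
    using E unfolding notin_spectrum_iff_bounded_below[of w \<omega>, OF B[OF \<omega>]] by blast
  have "sqnorm u \<le> K * sqnorm (?J \<eta> u)" if fin: "finite {n. u n \<noteq> 0}" for u
  proof -
    obtain j where j: "\<And>n. n \<in> {n. u n \<noteq> 0} \<Longrightarrow> \<omega> (n + j) = \<eta> n"
      using minimal_orbit_visits[OF min \<omega> \<eta> fin] by blast
    define u' where "u' n = u (n - j)" for n
    have "{n. u' n \<noteq> 0} = (\<lambda>n. n + j) ` {n. u n \<noteq> 0}"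
    proof (intro set_eqI iffI)
      fix n assume "n \<in> {n. u' n \<noteq> 0}"
      then have "n - j \<in> {n. u n \<noteq> 0}" by (simp add: u'_def)
      then show "n \<in> (\<lambda>n. n + j) ` {n. u n \<noteq> 0}" by (intro image_eqI[of _ _ "n - j"]) auto
    qed (auto simp: u'_def)
    then have "sqnorm u' \<le> K * sqnorm (?J \<omega> u')" using fin by (intro K) simp
    moreover have "sqnorm u' = sqnorm u"
      using sqnorm_shift[of u' j] by (simp add: u'_def)
    \<comment> \<open>Off the support of \<open>u\<close> the potential is multiplied by zero.\<close>
    moreover have "?J \<eta> u n = ?J \<omega> u' (n + j)" for n
      using j[of n] by (cases "u n = 0") (auto simp: jacobi_def u'_def algebra_simps)
    then have "?J \<eta> u = (\<lambda>n. ?J \<omega> u' (n + j))" by blast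
    then have "sqnorm (?J \<eta> u) = sqnorm (?J \<omega> u')"
      using sqnorm_shift[of "?J \<omega> u'" j] by simp
    ultimately show ?thesis by simp
  qed
  with K(1) show ?thesis
    unfolding notin_spectrum_iff_bounded_below[of w \<eta>, OF B[OF \<eta>]] by blast
qed

lemma subshift_spectrum_eq:
  assumes min: "minimal_subshift k \<Omega>" and \<omega>: "\<omega> \<in> \<Omega>"
  shows "subshift_spectrum \<Omega> w = complex_of_real -` spectrum (schroedinger w \<omega>)"
proof -
  have "complex_of_real -` spectrum (schroedinger w \<eta>) = complex_of_real -` spectrum (schroedinger w \<omega>)"
    if "\<eta> \<in> \<Omega>" for \<eta>
    using minimal_spectrum_mono[OF min \<omega> that] minimal_spectrum_mono[OF min that \<omega>] by blast
  then show ?thesis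
    unfolding subshift_spectrum_def using \<omega> by (intro the_equality) blast+
qed

section \<open>Solutions on a run of constant potential\<close>

text \<open>
  Multiplied by \<open>2 sin (x / 2)\<close>, the sum telescopes.
\<close>

lemma sum_cos_multiples:
  assumes "sin (x / 2) \<noteq> 0" "sin (real N * x) = 0"
  shows "(\<Sum>m<N. cos (real m * x)) = (1 - cos (real N * x)) / 2"
proof -
  have "2 * sin (x / 2) * (\<Sum>m<n. cos (real m * x)) = sin (real n * x - x / 2) + sin (x / 2)" for n
  proof (induction n)
    case (Suc n)
    have "2 * sin (x / 2) * (\<Sum>m<Suc n. cos (real m * x))
        = sin (real n * x - x / 2) + sin (x / 2) + 2 * sin (x / 2) * cos (real n * x)"
      using Suc by (simp add: distrib_left)
    also have "\<dots> = sin (real n * x + x / 2) + sin (x / 2)"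
      by (simp add: sin_add sin_diff)
    also have "real n * x + x / 2 = real (Suc n) * x - x / 2"
      by (simp add: field_simps)
    finally show ?case .
  qed simp
  from this[of N] have "2 * sin (x / 2) * (\<Sum>m<N. cos (real m * x)) = (1 - cos (real N * x)) * sin (x / 2)"
    using assms(2) by (simp add: sin_diff algebra_simps)
  then have "sin (x / 2) * (2 * (\<Sum>m<N. cos (real m * x)) - (1 - cos (real N * x))) = 0"
    by (simp add: algebra_simps)
  then show ?thesis using assms(1) by simp
qed

text \<open>
  The orthogonality of the Dirichlet eigenvectors on \<open>{1, \<dots>, N - 1}\<close>, which makes the
  discrete sine transform invertible. The product of sines is half the difference of the
  cosines of multiples of \<open>x\<close> and \<open>y\<close>; for \<open>i \<noteq> j\<close> the two cosine sums agree because
  \<open>i - j\<close> and \<open>i + j\<close> have the same parity.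
\<close>

lemma sine_orthogonality:
  assumes i: "1 \<le> i" "i < N" and j: "1 \<le> j" "j < N"
  shows "(\<Sum>m\<in>{1..<N}. sin (real i * (real m * pi / N)) * sin (real j * (real m * pi / N)))
    = (if i = j then N / 2 else 0)"
proof -
  define x where "x = (real i - real j) * pi / N"
  define y where "y = (real i + real j) * pi / N"
  have N: "0 < N" using i by simp
  have Nx: "real N * x = real i * pi - real j * pi" and Ny: "real N * y = real i * pi + real j * pi"
    using N by (simp_all add: x_def y_def field_simps)
  have zero: "sin (real N * x) = 0" "sin (real N * y) = 0"
    unfolding Nx Ny sin_diff sin_add by simp_all
  have "sin (y / 2) > 0"
  proof (rule sin_gt_zero)
    show "0 < y / 2" using i j by (simp add: y_def)
    have "(real i + real j) * pi < (real N * 2) * pi" using i j by (intro mult_strict_right_mono) auto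
    then show "y / 2 < pi" using N by (simp add: y_def field_simps)
  qed
  then have y: "(\<Sum>m<N. cos (real m * y)) = (1 - cos (real N * y)) / 2"
    using zero by (intro sum_cos_multiples) auto
  have x: "(\<Sum>m<N. cos (real m * x)) = (if i = j then real N else (1 - cos (real N * x)) / 2)"
  proof (cases "i = j")
    case False
    have "x / 2 \<noteq> 0" using False N by (simp add: x_def)
    moreover have "\<bar>x / 2\<bar> < pi"
    proof -
      have "\<bar>real i - real j\<bar> * pi < (real N * 2) * pi" using i j by (intro mult_strict_right_mono) auto
      then have "\<bar>real i - real j\<bar> * pi / (real N * 2) < pi"
        using N by (subst pos_divide_less_eq) (auto simp: mult.commute)
      moreover have "\<bar>x / 2\<bar> = \<bar>real i - real j\<bar> * pi / (real N * 2)"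
        by (simp add: x_def abs_mult)
      ultimately show ?thesis by simp
    qed
    ultimately have "sin (x / 2) \<noteq> 0" using sin_eq_0_pi[of "x / 2"] by linarith
    then show ?thesis using zero False by (simp add: sum_cos_multiples)
  qed (simp add: x_def)
  have "cos (real N * x) = cos (real N * y)"
    unfolding Nx Ny by (simp add: cos_add cos_diff)
  moreover have "cos (real N * y) = 1" if "i = j"
  proof -
    have "real N * y = 2 * real j * pi" using that Ny by simp
    then show ?thesis by (simp only: cos_2npi)
  qed
  moreover have "(\<Sum>m\<in>{1..<N}. sin (real i * (real m * pi / N)) * sin (real j * (real m * pi / N)))
      = (\<Sum>m<N. sin (real i * (real m * pi / N)) * sin (real j * (real m * pi / N)))"
    by (rule sum.mono_neutral_left) (auto simp: Suc_le_eq)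
  moreover have "\<dots> = (\<Sum>m<N. (cos (real m * x) - cos (real m * y)) / 2)"
  proof (rule sum.cong[OF refl])
    fix m
    have "real m * x = real i * (real m * pi / N) - real j * (real m * pi / N)"
      "real m * y = real i * (real m * pi / N) + real j * (real m * pi / N)"
      using N by (simp_all add: x_def y_def field_simps)
    then show "sin (real i * (real m * pi / N)) * sin (real j * (real m * pi / N))
        = (cos (real m * x) - cos (real m * y)) / 2"
      by (simp add: sin_times_sin)
  qed
  moreover have "\<dots> = ((\<Sum>m<N. cos (real m * x)) - (\<Sum>m<N. cos (real m * y))) / 2"
    by (simp add: sum_subtractf sum_divide_distrib[symmetric])
  ultimately show ?thesis using x y by auto
qed

text \<open>
  Green's identity for \<open>p\<close> and the solution \<open>s\<close> of \<open>s (i + 1) + s (i - 1) = 2 cos \<theta> s i\<close>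
  that vanishes at \<open>0\<close> and \<open>N\<close>: the two sums differ by the increments of the
  Wronskian of \<open>s\<close> and \<open>p\<close>, called \<open>W\<close> in the proof, which telescope.
\<close>

lemma sine_green_identity:
  fixes p f :: "nat \<Rightarrow> complex" and e \<theta> :: real
  assumes eq: "\<And>i. 1 \<le> i \<Longrightarrow> i < N \<Longrightarrow> p (i + 1) + p (i - 1) - of_real e * p i = f i"
    and \<theta>: "sin (real N * \<theta>) = 0" and N: "1 \<le> N"
  defines "s \<equiv> \<lambda>i. complex_of_real (sin (real i * \<theta>))"
  shows "of_real (2 * cos \<theta> - e) * (\<Sum>i\<in>{1..<N}. s i * p i)
    = (\<Sum>i\<in>{1..<N}. s i * f i) - s (N - 1) * p N - s 1 * p 0"
proof -
  have rec: "s (Suc (Suc i)) + s i = of_real (2 * cos \<theta>) * s (Suc i)" for i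
  proof -
    have "sin (real (Suc (Suc i)) * \<theta>) + sin (real i * \<theta>)
        = sin (real (Suc i) * \<theta> + \<theta>) + sin (real (Suc i) * \<theta> - \<theta>)"
      by (simp add: algebra_simps)
    also have "\<dots> = 2 * cos \<theta> * sin (real (Suc i) * \<theta>)"
      by (simp add: sin_add sin_diff)
    finally show ?thesis
      unfolding s_def by (metis of_real_add of_real_mult)
  qed
  define W where "W i = s i * p (Suc i) - s (Suc i) * p i" for i
  obtain n where n: "N = Suc n" using N by (cases N) auto
  have reindex: "(\<Sum>i\<in>{1..<N}. h i) = (\<Sum>i<n. h (Suc i))" for h :: "nat \<Rightarrow> complex"
    unfolding n by (rule sum.reindex_bij_witness[of _ Suc "\<lambda>i. i - 1"]) auto
  have "(\<Sum>i<n. s (Suc i) * f (Suc i)) - of_real (2 * cos \<theta> - e) * (\<Sum>i<n. s (Suc i) * p (Suc i))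
      = (\<Sum>i<n. s (Suc i) * f (Suc i) - of_real (2 * cos \<theta> - e) * (s (Suc i) * p (Suc i)))"
    by (simp add: sum_subtractf sum_distrib_left)
  also have "\<dots> = (\<Sum>i<n. W (Suc i) - W i)"
  proof (rule sum.cong[OF refl])
    fix i assume "i \<in> {..<n}"
    then have f: "f (Suc i) = p (Suc (Suc i)) + p i - of_real e * p (Suc i)"
      using eq[of "Suc i"] n by simp
    have "W (Suc i) - W i = s (Suc i) * (p (Suc (Suc i)) + p i) - (s (Suc (Suc i)) + s i) * p (Suc i)"
      by (simp add: W_def algebra_simps)
    then show "s (Suc i) * f (Suc i) - of_real (2 * cos \<theta> - e) * (s (Suc i) * p (Suc i)) = W (Suc i) - W i"
      unfolding rec f by (simp add: algebra_simps)
  qed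
  also have "\<dots> = W n - W 0" by (rule sum_lessThan_telescope)
  also have "\<dots> = s n * p (Suc n) + s 1 * p 0"
    using \<theta> by (simp add: W_def s_def n)
  finally show ?thesis
    unfolding reindex by (simp add: n algebra_simps)
qed

text \<open>
  Green's identity bounds each sine coefficient of \<open>p\<close> by the data divided by the distance of
  \<open>e\<close> from the Dirichlet eigenvalue \<open>2 cos (m \<pi> / N)\<close>, and the inverse sine transform
  recovers \<open>p\<close> from its coefficients.
\<close>

lemma dirichlet_run_bound_nat:
  fixes p f :: "nat \<Rightarrow> complex" and e \<delta> :: real
  assumes eq: "\<And>i. 1 \<le> i \<Longrightarrow> i < N \<Longrightarrow> p (i + 1) + p (i - 1) - of_real e * p i = f i"
    and \<delta>: "0 < \<delta>" and far: "\<And>m. m \<in> {1..<N} \<Longrightarrow> \<delta> \<le> \<bar>2 * cos (real m * pi / N) - e\<bar>"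
    and j: "1 \<le> j" "j < N"
  shows "cmod (p j) \<le> 2 / \<delta> * ((\<Sum>i\<in>{1..<N}. cmod (f i)) + cmod (p 0) + cmod (p N))"
proof -
  define T where "T = (\<Sum>i\<in>{1..<N}. cmod (f i)) + cmod (p 0) + cmod (p N)"
  define s where "s m i = complex_of_real (sin (real i * (real m * pi / N)))" for m i
  define c where "c m = (\<Sum>i\<in>{1..<N}. s m i * p i)" for m
  have N: "0 < N" using j by simp
  have s1: "cmod (s m i * z) \<le> cmod z" for m i z
  proof -
    have "cmod (s m i * z) = \<bar>sin (real i * (real m * pi / N))\<bar> * cmod z"
      by (simp add: s_def norm_mult)
    also have "\<dots> \<le> 1 * cmod z" by (intro mult_right_mono) auto
    finally show ?thesis by simp
  qed
  have c: "cmod (c m) \<le> T / \<delta>" if m: "m \<in> {1..<N}" for m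
  proof -
    have "real N * (real m * pi / N) = real m * pi" using N by simp
    then have "sin (real N * (real m * pi / N)) = 0" by simp
    from sine_green_identity[OF eq this] N
    have green: "of_real (2 * cos (real m * pi / N) - e) * c m
        = (\<Sum>i\<in>{1..<N}. s m i * f i) - s m (N - 1) * p N - s m 1 * p 0"
      by (simp add: c_def s_def)
    have "\<delta> * cmod (c m) \<le> \<bar>2 * cos (real m * pi / N) - e\<bar> * cmod (c m)"
      using far[OF m] by (intro mult_right_mono) auto
    also have "\<dots> = cmod (of_real (2 * cos (real m * pi / N) - e) * c m)"
      by (simp only: norm_mult norm_of_real)
    also have "\<dots> \<le> cmod (\<Sum>i\<in>{1..<N}. s m i * f i) + cmod (s m (N - 1) * p N) + cmod (s m 1 * p 0)"
      unfolding green by (intro order_trans[OF norm_triangle_ineq4] add_right_mono norm_triangle_ineq4)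
    also have "\<dots> \<le> (\<Sum>i\<in>{1..<N}. cmod (f i)) + cmod (p N) + cmod (p 0)"
      by (intro add_mono s1 order_trans[OF norm_sum] sum_mono)
    also have "\<dots> = T" by (simp add: T_def)
    finally show ?thesis using \<delta> by (simp add: field_simps)
  qed
  have "(\<Sum>m\<in>{1..<N}. s m j * c m) = (\<Sum>i\<in>{1..<N}. (\<Sum>m\<in>{1..<N}. s m j * s m i) * p i)"
    unfolding c_def sum_distrib_left sum_distrib_right mult.assoc by (rule sum.swap)
  also have "\<dots> = (\<Sum>i\<in>{1..<N}. (if i = j then of_real (N / 2) * p j else 0))"
  proof (rule sum.cong[OF refl])
    fix i assume i: "i \<in> {1..<N}"
    have "(\<Sum>m\<in>{1..<N}. s m j * s m i) = of_real (if j = i then N / 2 else 0)"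
      unfolding s_def of_real_mult[symmetric] of_real_sum[symmetric]
      using sine_orthogonality[of j N i] i j by simp
    then show "(\<Sum>m\<in>{1..<N}. s m j * s m i) * p i = (if i = j then of_real (N / 2) * p j else 0)"
      by simp
  qed
  also have "\<dots> = of_real (N / 2) * p j"
    using j by (simp add: sum.delta')
  finally have inversion: "of_real (N / 2) * p j = (\<Sum>m\<in>{1..<N}. s m j * c m)" ..
  have "real N / 2 * cmod (p j) = cmod (of_real (N / 2) * p j)"
    by (simp add: norm_mult)
  also have "\<dots> \<le> (\<Sum>m\<in>{1..<N}. cmod (s m j * c m))"
    unfolding inversion by (rule norm_sum)
  also have "\<dots> \<le> (\<Sum>m\<in>{1..<N}. T / \<delta>)"
    by (intro sum_mono order_trans[OF s1 c])
  also have "\<dots> = real (N - 1) * (T / \<delta>)" by simp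
  also have "\<dots> \<le> real N * (T / \<delta>)"
    using \<delta> by (intro mult_right_mono) (auto simp: T_def sum_nonneg)
  finally have "real N * (cmod (p j) / 2) \<le> real N * (T / \<delta>)" by simp
  then have "cmod (p j) / 2 \<le> T / \<delta>"
    using N by (simp only: mult_le_cancel_left_pos of_nat_0_less_iff)
  then have "cmod (p j) \<le> 2 / \<delta> * T"
    using \<delta> by (simp add: field_simps)
  then show ?thesis by (simp only: T_def)
qed

lemma dirichlet_run_bound:
  fixes u f :: "int \<Rightarrow> complex" and e \<delta> :: real
  assumes eq: "\<And>n. a < n \<Longrightarrow> n < b \<Longrightarrow> u (n + 1) + u (n - 1) - of_real e * u n = f n"
    and \<delta>: "0 < \<delta>"
    and far: "\<And>m. m \<in> {1..<nat (b - a)} \<Longrightarrow> \<delta> \<le> \<bar>2 * cos (real m * pi / nat (b - a)) - e\<bar>"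
    and n: "a < n" "n < b"
  shows "cmod (u n) \<le> 2 / \<delta> * ((\<Sum>i\<in>{a<..<b}. cmod (f i)) + cmod (u a) + cmod (u b))"
proof -
  define N where "N = nat (b - a)"
  define p where "p i = u (a + int i)" for i
  define g where "g i = f (a + int i)" for i
  have ab: "int N = b - a" using n by (simp add: N_def)
  have eq': "p (i + 1) + p (i - 1) - of_real e * p i = g i" if i: "1 \<le> i" "i < N" for i
    using eq[of "a + int i"] i ab by (simp add: p_def g_def of_nat_diff algebra_simps)
  have "cmod (p (nat (n - a))) \<le> 2 / \<delta> * ((\<Sum>i\<in>{1..<N}. cmod (g i)) + cmod (p 0) + cmod (p N))"
    by (rule dirichlet_run_bound_nat[OF eq' \<delta>]) (use far n in \<open>auto simp: N_def\<close>)
  moreover have "(\<Sum>i\<in>{1..<N}. cmod (g i)) = (\<Sum>i\<in>{a<..<b}. cmod (f i))"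
    unfolding g_def
    by (rule sum.reindex_bij_witness[of _ "\<lambda>i. nat (i - a)" "\<lambda>i. a + int i"]) (use ab in auto)
  moreover have "p (nat (n - a)) = u n" "p 0 = u a" "p N = u b"
    using n ab by (simp_all add: p_def)
  ultimately show ?thesis by simp
qed

section \<open>Energies outside the spectrum\<close>

text \<open>
  A pointwise bound by \<open>J u\<close> and \<open>u\<close> itself is useful once the contribution of \<open>u\<close> is
  small enough to be absorbed into the left-hand side.
\<close>

lemma jacobi_window_lower_bound:
  assumes V: "\<And>n. \<bar>V n\<bar> \<le> B" and u: "u \<in> ell2"
    and le: "\<And>n. cmod (u n) \<le> \<alpha> * window_sum M (jacobi V u) n + \<beta> * window_sum M u n"
    and \<beta>: "0 \<le> \<beta>" "(2 * real M + 1) * \<beta> \<le> 1 / 2"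
  shows "sqnorm u \<le> 4 * (2 * real M + 1)\<^sup>2 * \<alpha>\<^sup>2 * sqnorm (jacobi V u)"
proof -
  have "((2 * real M + 1) * \<beta>)\<^sup>2 \<le> (1 / 2)\<^sup>2"
    using \<beta> by (intro power_mono) auto
  then have "(2 * real M + 1)\<^sup>2 * \<beta>\<^sup>2 \<le> 1 / 4"
    unfolding power_mult_distrib by (simp add: power2_eq_square)
  then have "(2 * real M + 1)\<^sup>2 * \<beta>\<^sup>2 * sqnorm u \<le> 1 / 4 * sqnorm u"
    by (rule mult_right_mono) simp
  moreover have "sqnorm u \<le> 2 * (2 * real M + 1)\<^sup>2 * (\<alpha>\<^sup>2 * sqnorm (jacobi V u) + \<beta>\<^sup>2 * sqnorm u)"
    by (rule ell2_window_bound(2)[OF jacobi_bounded(1)[OF V u] u le])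
  then have "sqnorm u \<le> 2 * ((2 * real M + 1)\<^sup>2 * \<alpha>\<^sup>2 * sqnorm (jacobi V u))
      + 2 * ((2 * real M + 1)\<^sup>2 * \<beta>\<^sup>2 * sqnorm u)"
    by (simp add: algebra_simps)
  ultimately have "sqnorm u \<le> 4 * ((2 * real M + 1)\<^sup>2 * \<alpha>\<^sup>2 * sqnorm (jacobi V u))"
    by linarith
  then show ?thesis by (simp add: mult.assoc)
qed

lemma jacobi_large_potential_pointwise:
  assumes "0 < G" "G \<le> \<bar>V n\<bar>"
  shows "cmod (u n) \<le> 1 / G * (cmod (jacobi V u n) + (cmod (u (n + 1)) + cmod (u (n - 1))))"
proof -
  have "G * cmod (u n) \<le> \<bar>V n\<bar> * cmod (u n)"
    using assms(2) by (intro mult_right_mono) auto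
  also have "\<dots> = cmod (of_real (V n) * u n)"
    by (simp add: norm_mult)
  also have "of_real (V n) * u n = jacobi V u n - (u (n + 1) + u (n - 1))"
    by (simp add: jacobi_def)
  also have "cmod \<dots> \<le> cmod (jacobi V u n) + (cmod (u (n + 1)) + cmod (u (n - 1)))"
    by (intro order_trans[OF norm_triangle_ineq4] add_left_mono norm_triangle_ineq)
  finally show ?thesis using assms(1) by (simp add: field_simps)
qed

lemma jacobi_large_potential_window:
  assumes "0 < G" "G \<le> \<bar>V n\<bar>" "\<bar>n - c\<bar> < int M"
  shows "cmod (u n) \<le> 1 / G * (window_sum M (jacobi V u) c + window_sum M u c)"
proof -
  have "cmod (u (n + 1)) + cmod (u (n - 1)) = (\<Sum>m\<in>{n + 1, n - 1}. cmod (u m))"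
    by simp
  also have "\<dots> \<le> window_sum M u c"
    by (rule window_sum_ge_sum) (use assms(3) in auto)
  finally have "cmod (jacobi V u n) + (cmod (u (n + 1)) + cmod (u (n - 1)))
      \<le> window_sum M (jacobi V u) c + window_sum M u c"
    using window_sum_ge[of n c M "jacobi V u"] assms(3) by simp
  from order_trans[OF jacobi_large_potential_pointwise[where V = V and n = n, OF assms(1,2)]
      mult_left_mono[OF this]]
  show ?thesis using assms(1) by simp
qed

text \<open>
  Sites off \<open>A\<close>, where the potential is large, are controlled directly. A site in \<open>A\<close> lies
  in a run of \<open>A\<close> of bounded length, on which the equation is the free one with energy
  \<open>e\<close>; the end points of the run lie off \<open>A\<close>, so the boundary terms in the estimate for
  the run are small again. The two end points are at most \<open>4 L + 2\<close> apart.
\<close>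

lemma jacobi_run_window_bound:
  assumes G: "0 < G" and \<delta>: "0 < \<delta>"
    and V: "\<And>n. n \<in> A \<Longrightarrow> V n = - e" "\<And>n. n \<notin> A \<Longrightarrow> G \<le> \<bar>V n\<bar>"
    and gaps: "\<And>n. \<exists>m\<in>{n - int L..n + int L}. m \<notin> A"
    and far: "\<And>N m. N \<le> 4 * L + 2 \<Longrightarrow> m \<in> {1..<N} \<Longrightarrow> \<delta> \<le> \<bar>2 * cos (real m * pi / real N) - e\<bar>"
  shows "cmod (u n) \<le> (1 / G + 2 / \<delta> * (1 + 2 / G)) * window_sum (2 * L + 2) (jacobi V u) n
    + (1 / G + 4 / (\<delta> * G)) * window_sum (2 * L + 2) u n"
proof -
  let ?M = "2 * L + 2"
  define F where "F = window_sum ?M (jacobi V u) n"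
  define W where "W = window_sum ?M u n"
  have pos: "0 \<le> F" "0 \<le> W" by (simp_all add: F_def W_def window_sum_nonneg)
  have off: "cmod (u m) \<le> 1 / G * (F + W)" if "m \<notin> A" "\<bar>m - n\<bar> \<le> 2 * int L + 1" for m
    unfolding F_def W_def
    by (rule jacobi_large_potential_window[where V = V and n = m, OF G V(2)[OF that(1)]])
      (use that(2) in simp)
  show ?thesis
  proof (cases "n \<in> A")
    case False
    have "cmod (u n) \<le> 1 / G * (F + W)"
      using off[OF False] by simp
    also have "\<dots> \<le> (1 / G + 2 / \<delta> * (1 + 2 / G)) * F + (1 / G + 4 / (\<delta> * G)) * W"
      unfolding distrib_left using G \<delta> pos by (intro add_mono mult_right_mono) auto
    finally show ?thesis by (simp only: F_def W_def)
  next
    case True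
    \<comment> \<open>The nearest sites off \<open>A\<close> to the left and to the right of \<open>n\<close> bound its run.\<close>
    define S where "S = {m \<in> {n - (2 * int L + 1)..n - 1}. m \<notin> A}"
    define S' where "S' = {m \<in> {n + 1..n + (2 * int L + 1)}. m \<notin> A}"
    have fin: "finite S" "finite S'"
      unfolding S_def S'_def by (rule finite_subset[OF Collect_subset finite_atLeastAtMost_int])+
    have ne: "S \<noteq> {}" "S' \<noteq> {}"
    proof -
      show "S \<noteq> {}" using gaps[of "n - (int L + 1)"] by (force simp: S_def)
      show "S' \<noteq> {}" using gaps[of "n + (int L + 1)"] by (force simp: S'_def)
    qed
    define a where "a = Max S"
    define b where "b = Min S'"
    have a: "a \<in> S" and b: "b \<in> S'"
      using fin ne by (simp_all add: a_def b_def)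
    have ab: "n - (2 * int L + 1) \<le> a" "a < n" "n < b" "b \<le> n + (2 * int L + 1)" "a \<notin> A" "b \<notin> A"
      using a b by (auto simp: S_def S'_def)
    have inside: "m \<in> A" if "a < m" "m < b" for m
    proof (rule ccontr)
      assume m: "m \<notin> A"
      then have "m \<noteq> n" using True by auto
      then consider "m < n" | "n < m" by linarith
      then show False
      proof cases
        case 1
        then have "m \<in> S" using m that ab by (simp add: S_def)
        then show False using Max_ge[OF fin(1), of m] that by (simp add: a_def)
      next
        case 2
        then have "m \<in> S'" using m that ab by (simp add: S'_def)
        then show False using Min_le[OF fin(2), of m] that by (simp add: b_def)
      qed
    qed
    have "cmod (u n) \<le> 2 / \<delta> * ((\<Sum>i\<in>{a<..<b}. cmod (jacobi V u i)) + cmod (u a) + cmod (u b))"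
    proof (rule dirichlet_run_bound[OF _ \<delta>])
      fix m assume "a < m" "m < b"
      then show "u (m + 1) + u (m - 1) - of_real e * u m = jacobi V u m"
        by (simp add: jacobi_def V(1)[OF inside])
    next
      fix m assume "m \<in> {1..<nat (b - a)}"
      then show "\<delta> \<le> \<bar>2 * cos (real m * pi / real (nat (b - a))) - e\<bar>"
        using ab by (intro far) auto
    qed (use ab in auto)
    also have "\<dots> \<le> 2 / \<delta> * (F + 1 / G * (F + W) + 1 / G * (F + W))"
    proof (intro mult_left_mono add_mono)
      show "(\<Sum>i\<in>{a<..<b}. cmod (jacobi V u i)) \<le> F"
        unfolding F_def by (rule window_sum_ge_sum) (use ab in auto)
    qed (use ab off \<delta> in auto)
    also have "\<dots> = (2 / \<delta> * (1 + 2 / G)) * F + (4 / (\<delta> * G)) * W"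
      using G \<delta> by (simp add: field_simps)
    also have "\<dots> \<le> (1 / G + 2 / \<delta> * (1 + 2 / G)) * F + (1 / G + 4 / (\<delta> * G)) * W"
      using G pos by (intro add_mono mult_right_mono) auto
    finally show ?thesis by (simp only: F_def W_def)
  qed
qed

text \<open>
  The constant \<open>6\<close> is large enough for absorption with window radius \<open>1\<close>: the factor is
  \<open>3 * (1 / 6) = 1 / 2\<close>.
\<close>

lemma notin_spectrum_if_potential_far:
  assumes w: "\<And>n. \<bar>w (\<omega> n)\<bar> \<le> B" and far: "\<And>n. 6 \<le> \<bar>w (\<omega> n) - E\<bar>"
  shows "complex_of_real E \<notin> spectrum (schroedinger w \<omega>)"
proof -
  let ?V = "\<lambda>n. w (\<omega> n) - E"
  have V: "\<bar>?V n\<bar> \<le> B + \<bar>E\<bar>" for n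
    using w[of n] by linarith
  have "sqnorm u \<le> sqnorm (jacobi ?V u)" if fin: "finite {n. u n \<noteq> 0}" for u
  proof -
    have le: "cmod (u n) \<le> 1 / 6 * window_sum 1 (jacobi ?V u) n + 1 / 6 * window_sum 1 u n" for n
      using jacobi_large_potential_window[of 6 ?V n n 1 u] far[of n] by (simp add: distrib_left)
    show ?thesis
      using jacobi_window_lower_bound[OF V ell2_finite_support[OF fin] le]
      by (simp add: power2_eq_square)
  qed
  then show ?thesis
    unfolding notin_spectrum_iff_bounded_below[of w \<omega>, OF w] by (intro exI[of _ 1]) auto
qed

text \<open>
  The value \<open>x\<close> is the one that the energy is close to. The contribution of \<open>u\<close> is small
  although \<open>1 / \<delta>\<close> may be large: leaving a run of \<open>x\<close> always costs a factor \<open>1 / G\<close>.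
\<close>

lemma notin_spectrum_if_bounded_runs:
  assumes w: "\<And>n. \<bar>w (\<omega> n)\<bar> \<le> B" and G: "0 < G" and \<delta>: "0 < \<delta>"
    and sep: "\<And>n. w (\<omega> n) \<noteq> x \<Longrightarrow> G \<le> \<bar>w (\<omega> n) - E\<bar>"
    and gaps: "\<And>n. \<exists>m\<in>{n - int L..n + int L}. w (\<omega> m) \<noteq> x"
    and far: "\<And>N m. N \<le> 4 * L + 2 \<Longrightarrow> m \<in> {1..<N} \<Longrightarrow> \<delta> \<le> \<bar>x + 2 * cos (real m * pi / real N) - E\<bar>"
    and small: "(4 * real L + 5) * (1 / G + 4 / (\<delta> * G)) \<le> 1 / 2"
  shows "complex_of_real E \<notin> spectrum (schroedinger w \<omega>)"
proof -
  let ?V = "\<lambda>n. w (\<omega> n) - E"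
  let ?M = "2 * L + 2"
  let ?\<alpha> = "1 / G + 2 / \<delta> * (1 + 2 / G)"
  have V: "\<bar>?V n\<bar> \<le> B + \<bar>E\<bar>" for n
    using w[of n] by linarith
  have "sqnorm u \<le> 4 * (2 * real ?M + 1)\<^sup>2 * ?\<alpha>\<^sup>2 * sqnorm (jacobi ?V u)" if fin: "finite {n. u n \<noteq> 0}" for u
  proof (rule jacobi_window_lower_bound[OF V ell2_finite_support[OF fin]])
    fix n
    show "cmod (u n) \<le> ?\<alpha> * window_sum ?M (jacobi ?V u) n + (1 / G + 4 / (\<delta> * G)) * window_sum ?M u n"
    proof (rule jacobi_run_window_bound[OF G \<delta>, where A = "{n. w (\<omega> n) = x}" and e = "E - x"])
      show "\<delta> \<le> \<bar>2 * cos (real m * pi / real N) - (E - x)\<bar>" if "N \<le> 4 * L + 2" "m \<in> {1..<N}" for N m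
        using far[OF that] by (simp add: algebra_simps)
    qed (use sep gaps in auto)
  next
    show "0 \<le> 1 / G + 4 / (\<delta> * G)" using G \<delta> by simp
    show "(2 * real ?M + 1) * (1 / G + 4 / (\<delta> * G)) \<le> 1 / 2"
      using small by (simp add: algebra_simps)
  qed
  then show ?thesis
    unfolding notin_spectrum_iff_bounded_below[of w \<omega>, OF w]
    by (intro exI[of _ "4 * (2 * real ?M + 1)\<^sup>2 * ?\<alpha>\<^sup>2"]) auto
qed

section \<open>The measure of the spectrum\<close>

lemma emeasure_lebesgue_UN_Icc_le:
  fixes c :: "'i \<Rightarrow> real"
  assumes I: "finite I" and S: "S \<subseteq> (\<Union>i\<in>I. {c i - r..c i + r})" and r: "0 \<le> r"
  shows "emeasure lebesgue S \<le> ennreal (2 * real (card I) * r)"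
proof -
  have "emeasure lebesgue S \<le> emeasure lebesgue (\<Union>i\<in>I. {c i - r..c i + r})"
    using I by (intro emeasure_mono S sets.finite_UN) auto
  also have "\<dots> \<le> (\<Sum>i\<in>I. emeasure lebesgue {c i - r..c i + r})"
    using I by (intro emeasure_subadditive_finite) auto
  also have "\<dots> = (\<Sum>i\<in>I. ennreal (2 * r))"
    using r by (intro sum.cong[OF refl]) simp
  also have "\<dots> = ennreal (2 * real (card I) * r)"
    using r by (subst sum_ennreal) (auto simp: mult_ac)
  finally show ?thesis .
qed

text \<open>
  Both bounds cover the spectrum by finitely many intervals, whose number does not depend on
  the coupling constant: intervals of radius \<open>6\<close> around the values of the potential always
  do, and for large coupling so do intervals of radius \<open>K / lam\<close> around the shifted Dirichlet
  eigenvalues of the finitely many possible runs. The scales match because the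
  potential values are separated by a multiple of \<open>lam\<close>, so that the product of \<open>\<delta> = K / lam\<close>
  and \<open>G = c * lam\<close> is a constant, made large by the choice of \<open>K\<close>.
\<close>

theorem subshift_spectrum_measure_le:
  fixes v :: "nat \<Rightarrow> real"
  assumes min: "minimal_subshift k \<Omega>" and occ: "\<forall>a\<in>{1..k}. occurs a \<Omega>"
    and nonconst: "\<not> v constant_on {1..k}"
  obtains D \<Lambda> where "0 < D" "1 \<le> \<Lambda>"
    "\<And>lam. 0 < lam \<Longrightarrow> emeasure lebesgue (subshift_spectrum \<Omega> (\<lambda>a. lam * v a)) \<le> ennreal D"
    "\<And>lam. \<Lambda> \<le> lam \<Longrightarrow> emeasure lebesgue (subshift_spectrum \<Omega> (\<lambda>a. lam * v a)) \<le> ennreal (D / lam)"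
proof -
  have sub: "subshift k \<Omega>" using min by (simp add: minimal_subshift_def)
  obtain \<omega> where \<omega>: "\<omega> \<in> \<Omega>" using sub by (auto simp: subshift_def)
  define X where "X = v ` {1..k}"
  have X: "finite X" by (simp add: X_def)
  have vX: "v (\<omega> n) \<in> X" for n
    unfolding X_def using subshift_letters[OF sub \<omega>] by (rule imageI)
  have spec: "subshift_spectrum \<Omega> (\<lambda>a. lam * v a)
      = complex_of_real -` spectrum (schroedinger (\<lambda>a. lam * v a) \<omega>)" for lam
    by (rule subshift_spectrum_eq[OF min \<omega>])
  define B where "B = (\<Sum>a\<in>{1..k}. \<bar>v a\<bar>)"
  have B: "\<bar>lam * v (\<omega> n)\<bar> \<le> \<bar>lam\<bar> * B" for lam n
    unfolding abs_mult B_def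
    by (intro mult_left_mono member_le_sum[where f = "\<lambda>a. \<bar>v a\<bar>"])
      (use subshift_letters[OF sub \<omega>] in auto)
  \<comment> \<open>No value can be taken along a long run, since both \<open>a\<close> and \<open>b\<close> recur.\<close>
  obtain a b where ab: "a \<in> {1..k}" "b \<in> {1..k}" "v a \<noteq> v b"
    using nonconst unfolding constant_on_def by metis
  obtain La where La: "\<And>n. \<exists>m\<in>{n - int La..n + int La}. \<omega> m = a"
    using minimal_letter_syndetic[OF min, of a] occ ab(1) \<omega> by metis
  obtain Lb where Lb: "\<And>n. \<exists>m\<in>{n - int Lb..n + int Lb}. \<omega> m = b"
    using minimal_letter_syndetic[OF min, of b] occ ab(2) \<omega> by metis
  define L where "L = max La Lb"
  have gaps: "\<exists>m\<in>{n - int L..n + int L}. v (\<omega> m) \<noteq> x" for n x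
  proof -
    obtain m m' where m: "m \<in> {n - int La..n + int La}" "\<omega> m = a"
      and m': "m' \<in> {n - int Lb..n + int Lb}" "\<omega> m' = b"
      using La Lb by blast
    have "m \<in> {n - int L..n + int L}" "m' \<in> {n - int L..n + int L}"
      using m(1) m'(1) by (auto simp: L_def)
    moreover have "v (\<omega> m) \<noteq> x \<or> v (\<omega> m') \<noteq> x"
      using m(2) m'(2) ab(3) by auto
    ultimately show ?thesis by blast
  qed
  obtain d where d: "0 < d" "\<And>x y. x \<in> X \<Longrightarrow> y \<in> X \<Longrightarrow> x \<noteq> y \<Longrightarrow> d \<le> \<bar>y - x\<bar>"
  proof -
    define P where "P = (\<lambda>(x, y). \<bar>y - x\<bar>) ` {(x, y) \<in> X \<times> X. x \<noteq> y}"
    have "finite {(x, y) \<in> X \<times> X. x \<noteq> y}"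
      using finite_cartesian_product[OF X X] by (rule rev_finite_subset) auto
    then have "finite P" unfolding P_def by (rule finite_imageI)
    moreover have "(v a, v b) \<in> {(x, y) \<in> X \<times> X. x \<noteq> y}" using ab by (auto simp: X_def)
    then have "P \<noteq> {}" unfolding P_def by blast
    moreover have "\<forall>p\<in>P. 0 < p" by (auto simp: P_def)
    ultimately have "0 < Min P" "\<And>p. p \<in> P \<Longrightarrow> Min P \<le> p" by auto
    then show ?thesis by (intro that[of "Min P"]) (auto simp: P_def)
  qed
  define c where "c = d / 2"
  have c: "0 < c" using d by (simp add: c_def)
  define K where "K = 16 * (4 * real L + 5) / c"
  have K: "0 < K" using c by (simp add: K_def)
  define \<Lambda> where "\<Lambda> = max 1 (4 * (4 * real L + 5) / c)"
  define R where "R = {(N, m). N \<le> 4 * L + 2 \<and> m \<in> {1..<N}}"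
  have R: "finite R"
    by (rule finite_subset[of _ "{..4 * L + 2} \<times> {..4 * L + 2}"]) (auto simp: R_def)
  define D where "D = 12 * real (card X) + 2 * real (card (X \<times> R)) * K + 1"
  have D: "0 < D" "12 * real (card X) \<le> D" "2 * real (card (X \<times> R)) * K \<le> D"
    unfolding D_def using K by (simp_all add: add_nonneg_pos)
  have bounded: "emeasure lebesgue (subshift_spectrum \<Omega> (\<lambda>a. lam * v a)) \<le> ennreal D" for lam
  proof -
    have "subshift_spectrum \<Omega> (\<lambda>a. lam * v a) \<subseteq> (\<Union>x\<in>X. {lam * x - 6..lam * x + 6})"
    proof
      fix E assume E: "E \<in> subshift_spectrum \<Omega> (\<lambda>a. lam * v a)"
      have "\<not> (\<forall>n. 6 \<le> \<bar>lam * v (\<omega> n) - E\<bar>)"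
        using notin_spectrum_if_potential_far[of "\<lambda>a. lam * v a" \<omega> _ E] B E unfolding spec by blast
      then obtain n where "\<bar>lam * v (\<omega> n) - E\<bar> < 6" by (auto simp: not_le)
      then have "E \<in> {lam * v (\<omega> n) - 6..lam * v (\<omega> n) + 6}" by auto
      then show "E \<in> (\<Union>x\<in>X. {lam * x - 6..lam * x + 6})" using vX by blast
    qed
    from emeasure_lebesgue_UN_Icc_le[OF X this] have
      "emeasure lebesgue (subshift_spectrum \<Omega> (\<lambda>a. lam * v a)) \<le> ennreal (12 * real (card X))"
      by (simp add: mult_ac)
    also have "\<dots> \<le> ennreal D" using D by (intro ennreal_leI)
    finally show ?thesis .
  qed
  have decay: "emeasure lebesgue (subshift_spectrum \<Omega> (\<lambda>a. lam * v a)) \<le> ennreal (D / lam)"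
    if lam: "\<Lambda> \<le> lam" for lam
  proof -
    have lam_pos: "0 < lam" using lam by (simp add: \<Lambda>_def)
    have "subshift_spectrum \<Omega> (\<lambda>a. lam * v a)
        \<subseteq> (\<Union>(x, N, m)\<in>X \<times> R. {lam * x + 2 * cos (real m * pi / real N) - K / lam
                                ..lam * x + 2 * cos (real m * pi / real N) + K / lam})" (is "_ \<subseteq> ?U")
    proof
      fix E assume E: "E \<in> subshift_spectrum \<Omega> (\<lambda>a. lam * v a)"
      show "E \<in> ?U"
      proof (rule ccontr)
        assume notU: "E \<notin> ?U"
        have "X \<noteq> {}" using vX by blast
        \<comment> \<open>The value closest to \<open>E\<close>; all others have distance at least \<open>lam * d / 2\<close> from \<open>E\<close>.\<close>
        then obtain x where x: "x \<in> X" "\<And>y. y \<in> X \<Longrightarrow> \<bar>lam * x - E\<bar> \<le> \<bar>lam * y - E\<bar>"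
          using ex_is_arg_min_if_finite[OF X, of "\<lambda>y. \<bar>lam * y - E\<bar>"]
          by (auto simp: is_arg_min_linorder)
        have "complex_of_real E \<notin> spectrum (schroedinger (\<lambda>a. lam * v a) \<omega>)"
        proof (rule notin_spectrum_if_bounded_runs[where x = "lam * x" and \<delta> = "K / lam" and G = "c * lam"])
          show "\<bar>lam * v (\<omega> n)\<bar> \<le> \<bar>lam\<bar> * B" for n by (rule B)
          show "0 < c * lam" "0 < K / lam" using c K lam_pos by auto
          show "c * lam \<le> \<bar>lam * v (\<omega> n) - E\<bar>" if ne: "lam * v (\<omega> n) \<noteq> lam * x" for n
          proof -
            let ?y = "v (\<omega> n)"
            have "d * lam \<le> \<bar>?y - x\<bar> * lam"
              using d(2)[OF x(1) vX, of n] ne lam_pos by (intro mult_right_mono) auto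
            also have "\<dots> = \<bar>lam * ?y - lam * x\<bar>"
              using lam_pos by (simp add: right_diff_distrib[symmetric] abs_mult)
            also have "\<dots> \<le> 2 * \<bar>lam * ?y - E\<bar>"
              using x(2)[OF vX, of n] abs_triangle_ineq4[of "lam * ?y - E" "lam * x - E"] by simp
            finally show ?thesis by (simp add: c_def)
          qed
          show "\<exists>m\<in>{n - int L..n + int L}. lam * v (\<omega> m) \<noteq> lam * x" for n
            using gaps[of n x] lam_pos by auto
          show "K / lam \<le> \<bar>lam * x + 2 * cos (real m * pi / real N) - E\<bar>"
            if "N \<le> 4 * L + 2" "m \<in> {1..<N}" for N m
          proof -
            have "(x, N, m) \<in> X \<times> R" using x(1) that by (simp add: R_def)
            then have "E \<notin> {lam * x + 2 * cos (real m * pi / real N) - K / lam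
                ..lam * x + 2 * cos (real m * pi / real N) + K / lam}"
              using notU by blast
            then show ?thesis by auto
          qed
          show "(4 * real L + 5) * (1 / (c * lam) + 4 / (K / lam * (c * lam))) \<le> 1 / 2"
          proof -
            have "4 * (4 * real L + 5) / c \<le> lam" using lam by (simp add: \<Lambda>_def)
            then have "(4 * real L + 5) / (c * lam) \<le> 1 / 4"
              using c lam_pos by (simp add: field_simps)
            moreover have "(4 * real L + 5) * 4 / (K * c) = 1 / 4"
            proof -
              have "K * c = 16 * (4 * real L + 5)" using c by (simp add: K_def)
              moreover have "0 < 4 * real L + 5" by (simp add: add_nonneg_pos)
              then have "(4 * real L + 5) * 4 / (16 * (4 * real L + 5)) = 1 / 4"
                by (subst nonzero_divide_eq_eq) auto
              ultimately show ?thesis by simp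
            qed
            moreover have "K / lam * (c * lam) = K * c" using lam_pos by simp
            then have "(4 * real L + 5) * (1 / (c * lam) + 4 / (K / lam * (c * lam)))
                = (4 * real L + 5) / (c * lam) + (4 * real L + 5) * 4 / (K * c)"
              by (simp only: distrib_left times_divide_eq_right mult_1_right)
            ultimately show ?thesis by linarith
          qed
        qed
        with E show False unfolding spec by blast
      qed
    qed
    then have "subshift_spectrum \<Omega> (\<lambda>a. lam * v a)
        \<subseteq> (\<Union>i\<in>X \<times> R. {(case i of (x, N, m) \<Rightarrow> lam * x + 2 * cos (real m * pi / real N)) - K / lam
                        ..(case i of (x, N, m) \<Rightarrow> lam * x + 2 * cos (real m * pi / real N)) + K / lam})"
      by (simp add: case_prod_unfold)
    from emeasure_lebesgue_UN_Icc_le[OF finite_cartesian_product[OF X R] this]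
    have "emeasure lebesgue (subshift_spectrum \<Omega> (\<lambda>a. lam * v a))
        \<le> ennreal (2 * real (card (X \<times> R)) * (K / lam))"
      using K lam_pos by simp
    also have "\<dots> \<le> ennreal (D / lam)"
      using D(3) lam_pos by (intro ennreal_leI) (simp add: divide_right_mono)
    finally show ?thesis .
  qed
  have "1 \<le> \<Lambda>" by (simp add: \<Lambda>_def)
  then show ?thesis
    by (rule that[OF D(1) _ bounded decay])
qed

text \<open>
  The decay \<open>1 / lam\<close> is faster than \<open>lam powr (- \<gamma>)\<close> for \<open>lam \<ge> 1\<close>. Below the threshold
  \<open>\<Lambda>\<close> the constant bound is used, at the price of the factor \<open>\<Lambda> powr \<gamma>\<close>; the factor
  \<open>2\<close> makes the inequality strict.
\<close>

theorem theorem2: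
  fixes k :: nat and \<Omega> :: "(int \<Rightarrow> nat) set" and \<gamma> :: real and v :: "nat \<Rightarrow> real"
  assumes "k \<ge> 2"
    and "minimal_subshift k \<Omega>"
    and "aperiodic \<Omega>"
    and "\<forall>a\<in>{1..k}. occurs a \<Omega>"
    and "0 < \<gamma>" and "\<gamma> < 1 / 4"
    and "\<not> v constant_on {1..k}"
  shows "\<exists>C>0. \<forall>lam>0.
    emeasure lebesgue (subshift_spectrum \<Omega> (\<lambda>a. lam * v a)) < ennreal (C * lam powr (- \<gamma>))"
proof -
  obtain D \<Lambda> where D: "0 < D" and \<Lambda>: "1 \<le> \<Lambda>"
    and bounded: "\<And>lam. 0 < lam \<Longrightarrow>
      emeasure lebesgue (subshift_spectrum \<Omega> (\<lambda>a. lam * v a)) \<le> ennreal D"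
    and decay: "\<And>lam. \<Lambda> \<le> lam \<Longrightarrow>
      emeasure lebesgue (subshift_spectrum \<Omega> (\<lambda>a. lam * v a)) \<le> ennreal (D / lam)"
    using subshift_spectrum_measure_le[OF assms(2,4,7)] by blast
  define C where "C = 2 * D * \<Lambda> powr \<gamma>"
  have \<Lambda>1: "1 \<le> \<Lambda> powr \<gamma>" using \<Lambda> assms(5) by (simp add: ge_one_powr_ge_zero)
  have C: "2 * D \<le> C" using D \<Lambda>1 mult_left_mono[of 1 "\<Lambda> powr \<gamma>" "2 * D"] by (simp add: C_def)
  have "emeasure lebesgue (subshift_spectrum \<Omega> (\<lambda>a. lam * v a)) < ennreal (C * lam powr (- \<gamma>))"
    if lam: "0 < lam" for lam
  proof (cases "\<Lambda> \<le> lam")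
    case True
    have "D / lam = D * lam powr (- 1)"
      using lam by (simp add: powr_minus_divide)
    also have "\<dots> \<le> D * lam powr (- \<gamma>)"
      using True \<Lambda> assms(6) D by (intro mult_left_mono powr_mono) auto
    also have "\<dots> < C * lam powr (- \<gamma>)"
      using C D lam by (intro mult_strict_right_mono) auto
    finally have "ennreal (D / lam) < ennreal (C * lam powr (- \<gamma>))"
      using D lam by (intro ennreal_lessI) (auto intro: order.strict_trans1[of 0 "D / lam"])
    with decay[OF True] show ?thesis by (rule order.strict_trans1)
  next
    case False
    have "1 = \<Lambda> powr \<gamma> * \<Lambda> powr (- \<gamma>)"
      using \<Lambda> by (simp add: powr_add[symmetric])
    also have "\<dots> \<le> \<Lambda> powr \<gamma> * lam powr (- \<gamma>)"
      using False lam assms(5) by (intro mult_left_mono powr_mono2') auto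
    finally have "2 * D * 1 \<le> 2 * D * (\<Lambda> powr \<gamma> * lam powr (- \<gamma>))"
      using D by (intro mult_left_mono) auto
    then have "D < C * lam powr (- \<gamma>)"
      using D by (simp add: C_def mult.assoc)
    then have "ennreal D < ennreal (C * lam powr (- \<gamma>))"
      using D by (intro ennreal_lessI) auto
    with bounded[OF lam] show ?thesis by (rule order.strict_trans1)
  qed
  then show ?thesis using C D by (intro exI[of _ C]) auto
qed

end
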